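(* For any integer partition $\lambda$ of a positive integer, under the specialization $e_n\mapsto q^{\binom n2}/n!$ ($n\ge 0$), the augmented monomial symmetric function $\widetilde{m_\lambda}=m(\lambda)!\,m_\lambda$ is given by $$\widetilde{m_{\lambda}}=(1-q)^{|\lambda|-l(\lambda)}\,M_\lambda(q),$$ where $M_\lambda(q)$ belongs to $\mathbb{Q}[q]$ and satisfies: (a) The degree of $M_\lambda$ is $d(\lambda)=\binom{|\lambda|-1}{2}+l(\lambda)-1$, and $\langle q^{d(\lambda)}\rangle M_\lambda=\dfrac{(l(\lambda)-1)!}{(|\lambda|-1)!}$. (b) The order of $M_\lambda$ is $\mathrm{ord}(M_\lambda)=n(\lambda)$, and $\langle q^{n(\lambda)}\rangle M_\lambda=\dfrac{m(\lambda)!}{\lambda'!}$. (c) For $\lambda=(n)$ with $n\ge 1$, $M_{(n)}=\dfrac{J_n}{(n-1)!}$.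
   Context: Let $\Lambda$ be the algebra of symmetric functions in $x_1,x_2,\dots$ over $\mathbb{Q}(q)$, with monomial symmetric functions $m_\lambda$ and elementary symmetric functions $e_n$ ($e_0=1$). The specialization considered is the $\mathbb{Q}(q)$-algebra homomorphism $\Lambda\to\mathbb{Q}(q)$ determined by $e_n\mapsto q^{\binom n2}/n!$, i.e. $\sum_{n\ge0}e_nt^n=E_{xq}(t)=\sum_{n\ge0}q^{\binom n2}t^n/n!$; symmetric functions are identified with their images. For a partition $\lambda=(\lambda_1\ge\dots\ge\lambda_r>0)$: $|\lambda|=\lambda_1+\dots+\lambda_r$, $l(\lambda)=r$, $n(\lambda)=\sum_{i\ge1}(i-1)\lambda_i$; $\lambda'$ is the conjugate partition; $\lambda'!=\prod_i\lambda'_i!$; if $r_i$ is the number of parts of $\lambda$ equal to $i$, then $m(\lambda)!=r_1!\,r_2!\cdots$. For a polynomial $P$ in $q$, $\langle q^k\rangle P$ is the coefficient of $q^k$, and $\mathrm{ord}(P)$ is the smallest power of $q$ with nonzero coefficient. $J_n$ ($n\ge1$) is the polynomial characterized by $p_n=m_{(n)}=\frac{(1-q)^{n-1}}{(n-1)!}J_n(q)$ under this specialization ($p_n$ the power sum). It is a known fact that $J_n$ is the inversion enumerator of labelled trees on $n$ vertices, $J_n(q)=\sum_T q^{\mathrm{inv}(T)}$, over trees $T$ on $\{1,\dots,n\}$ rooted at $1$, where $\mathrm{inv}(T)$ is the number of pairs $i<j$ such that $j$ lies on the path from $1$ to $i$; it is monic of degree $\binom{n-1}2$ with constant term $(n-1)!$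 and positive integer coefficients. *)

theory Defs
  imports
    "HOL-Computational_Algebra.Computational_Algebra"
    "HOL-Library.Poly_Mapping"
begin

subsection \<open>Symmetric functions in countably many variables\<close>

text \<open>
  A monomial in the variables $x_0, x_1, \dots$ is its finitely supported exponent vector, and a
  formal power series is its coefficient function on monomials.
\<close>

type_synonym monomial = "nat \<Rightarrow>\<^sub>0 nat"
type_synonym 'a series = "monomial \<Rightarrow> 'a"

definition mdeg :: "monomial \<Rightarrow> nat" where
  "mdeg m = (\<Sum>i\<in>Poly_Mapping.keys m. Poly_Mapping.lookup m i)"

definition symfuns :: "'a::comm_ring_1 series set" where
  "symfuns = {f. (\<exists>d. \<forall>m. f m \<noteq> 0 \<longrightarrow> mdeg m \<le> d) \<and>
                 (\<forall>\<pi> m. bij \<pi> \<longrightarrow> f (Poly_Mapping.map_key \<pi> m) = f m)}"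

definition series_one :: "'a::comm_ring_1 series" where
  "series_one = (\<lambda>m. if m = 0 then 1 else 0)"

definition series_add :: "'a::comm_ring_1 series \<Rightarrow> 'a series \<Rightarrow> 'a series" where
  "series_add f g = (\<lambda>m. f m + g m)"

definition series_scale :: "'a::comm_ring_1 \<Rightarrow> 'a series \<Rightarrow> 'a series" where
  "series_scale c f = (\<lambda>m. c * f m)"

definition series_mult :: "'a::comm_ring_1 series \<Rightarrow> 'a series \<Rightarrow> 'a series" where
  "series_mult f g = (\<lambda>m. \<Sum>(a, b)\<in>{(a, b). a + b = m}. f a * g b)"

text \<open>The index set in \<open>series_mult\<close> is finite, so the sum there is a genuine one.\<close>

lemma finite_monomial_splittings: "finite {(a, b). a + b = (m :: monomial)}"
proof -
  let ?F = "{f. \<forall>i. (i \<in> Poly_Mapping.keys m \<longrightarrow> f i \<in> {..mdeg m}) \<and>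
                    (i \<notin> Poly_Mapping.keys m \<longrightarrow> f i = (0::nat))}"
  let ?A = "{a. \<forall>i. Poly_Mapping.lookup a i \<le> Poly_Mapping.lookup m i}"
  have "finite ?F"
    by (rule finite_set_of_finite_funs) auto
  moreover have "Poly_Mapping.lookup ` ?A \<subseteq> ?F"
  proof (rule image_subsetI)
    fix a assume a: "a \<in> ?A"
    have "Poly_Mapping.lookup a i \<le> mdeg m" if i: "i \<in> Poly_Mapping.keys m" for i
    proof -
      have "Poly_Mapping.lookup m i \<le> mdeg m"
        unfolding mdeg_def by (rule member_le_sum[OF i]) auto
      with a show ?thesis by (auto intro: order_trans)
    qed
    moreover have "Poly_Mapping.lookup a i = 0" if "i \<notin> Poly_Mapping.keys m" for i
      using a that by (auto simp: in_keys_iff) (metis le_zero_eq)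
    ultimately show "Poly_Mapping.lookup a \<in> ?F" by auto
  qed
  moreover have "inj_on Poly_Mapping.lookup ?A"
    by (rule inj_onI) (simp add: Poly_Mapping.lookup_inject)
  ultimately have "finite ?A"
    by (meson finite_imageD finite_subset)
  moreover have "{(a, b). a + b = m} \<subseteq> ?A \<times> ?A"
    by (auto simp: lookup_add)
  ultimately show ?thesis
    by (meson finite_SigmaI finite_subset)
qed

definition symfun_algebra_hom :: "('a::comm_ring_1 series \<Rightarrow> 'a) \<Rightarrow> bool" where
  "symfun_algebra_hom \<phi> \<longleftrightarrow>
     \<phi> series_one = 1 \<and>
     (\<forall>f\<in>symfuns. \<forall>g\<in>symfuns. \<phi> (series_add f g) = \<phi> f + \<phi> g) \<and>
     (\<forall>f\<in>symfuns. \<forall>g\<in>symfuns. \<phi> (series_mult f g) = \<phi> f * \<phi> g) \<and>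
     (\<forall>c. \<forall>f\<in>symfuns. \<phi> (series_scale c f) = c * \<phi> f)"

definition elem_sym :: "nat \<Rightarrow> 'a::comm_ring_1 series" where
  "elem_sym n = (\<lambda>m. if mdeg m = n \<and> (\<forall>i. Poly_Mapping.lookup m i \<le> 1) then 1 else 0)"

text \<open>This is the power sum $p_n$ only for $n \ge 1$.\<close>

definition power_sum :: "nat \<Rightarrow> 'a::comm_ring_1 series" where
  "power_sum n = (\<lambda>m. if \<exists>i. m = Poly_Mapping.single i n then 1 else 0)"


subsection \<open>Partitions\<close>

definition is_partition :: "nat list \<Rightarrow> bool" where
  "is_partition la \<longleftrightarrow> sorted_wrt (\<ge>) la \<and> (\<forall>k\<in>set la. k > 0)"

text \<open>The exponents occurring in the monomial, sorted decreasingly, form the partition.\<close>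

definition monomial_sym :: "nat list \<Rightarrow> 'a::comm_ring_1 series" where
  "monomial_sym la =
     (\<lambda>m. if image_mset (Poly_Mapping.lookup m) (mset_set (Poly_Mapping.keys m)) = mset la then 1 else 0)"

definition mult_fact :: "nat list \<Rightarrow> nat" where
  "mult_fact la = (\<Prod>i\<in>set la. fact (count_list la i))"

definition aug_monomial_sym :: "nat list \<Rightarrow> 'a::comm_ring_1 series" where
  "aug_monomial_sym la = series_scale (of_nat (mult_fact la)) (monomial_sym la)"

definition conj_partition :: "nat list \<Rightarrow> nat list" where
  "conj_partition la = map (\<lambda>i. length (filter (\<lambda>k. i \<le> k) la)) [1..<Suc (Max (insert 0 (set la)))]"

definition parts_fact :: "nat list \<Rightarrow> nat" where
  "parts_fact la = prod_list (map fact la)"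

definition n_stat :: "nat list \<Rightarrow> nat" where
  "n_stat la = (\<Sum>i<length la. i * la ! i)"


subsection \<open>The specialization over the rational function field\<close>

type_synonym ratfun = "rat poly fract"

definition qvar :: ratfun where
  "qvar = to_fract [:0, 1:]"

definition is_specialization :: "(ratfun series \<Rightarrow> ratfun) \<Rightarrow> bool" where
  "is_specialization \<phi> \<longleftrightarrow>
     symfun_algebra_hom \<phi> \<and> (\<forall>n. \<phi> (elem_sym n) = qvar ^ (n choose 2) / of_nat (fact n))"

definition poly_ord :: "rat poly \<Rightarrow> nat" where
  "poly_ord P = (LEAST k. coeff P k \<noteq> 0)"

text \<open>
  \<open>J_poly \<phi> n\<close> is the polynomial determined by $p_n = (1-q)^{n-1} J_n / (n-1)!$ under the
  specialization \<open>\<phi>\<close>; it is meaningful for \<open>n \<ge> 1\<close>, and unique because $1 - q \ne 0$.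
\<close>

definition J_poly :: "(ratfun series \<Rightarrow> ratfun) \<Rightarrow> nat \<Rightarrow> rat poly" where
  "J_poly \<phi> n = (THE P. \<phi> (power_sum n) = (1 - qvar) ^ (n - 1) / of_nat (fact (n - 1)) * to_fract P)"

end

theory Submission
  imports Defs "HOL-Combinatorics.Permutations"
begin

text \<open>
  Divisibility by powers of $1-q$, the degree and the leading coefficient come from
  $p_a \widetilde{m_\lambda} = \widetilde{m_{\lambda\cup(a)}} + \sum_j \widetilde{m_{\lambda+a e_j}}$,
  which under the specialization reads
  $M_{\lambda\cup(a)} = M_{(a)} M_\lambda - (1-q)\sum_j M_{\lambda+a e_j}$; its last sum carries the
  top degree. For one part, the series $F(t)=\sum_n e_n t^n$ satisfies $F'(t)=F(qt)$, so
  $G = F'/F = \sum_n (-1)^n p_{n+1} t^n$ solves $G'(t) = G(t)\,(q\,G(qt) - G(t))$, that is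
  $(n-1)\,p_n = \sum_{k=1}^{n-1} (1-q^k)\, p_k\, p_{n-k}$.

  For the order, let $k = l(\lambda)$ and let $\mu$ be $\lambda$ without its first column. Then
  $e_k m_\mu = m_\lambda + \sum_\nu c_\nu m_\nu$ over partitions $\nu$ with $n(\nu) > n(\lambda)$ and
  $l(\nu) > l(\lambda)$, while $e_k$ specializes to $q^{\binom k2}/k!$. The inequality for $n$ follows from
  $2n(\lambda)+|\lambda| = \sum_{i,j} \min(\lambda_i,\lambda_j)$ and the superadditivity of the minimum.
\<close>

subsection \<open>Monomial symmetric functions indexed by multisets\<close>

text \<open>Partitions are handled as multisets of positive parts, so that adding, removing or
  merging parts needs no re-sorting.\<close>

definition mtype :: "monomial \<Rightarrow> nat multiset" where
  "mtype m = image_mset (Poly_Mapping.lookup m) (mset_set (Poly_Mapping.keys m))"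

definition msym :: "nat multiset \<Rightarrow> 'a::comm_ring_1 series" where
  "msym X = (\<lambda>m. if mtype m = X then 1 else 0)"

lemma monomial_sym_eq_msym: "monomial_sym la = msym (mset la)"
  by (simp add: monomial_sym_def msym_def mtype_def)

lemma mdeg_eq_sum_mset: "mdeg m = sum_mset (mtype m)"
  by (simp add: mdeg_def mtype_def sum_unfold_sum_mset)

lemma mdeg_superset:
  assumes "finite K" "Poly_Mapping.keys m \<subseteq> K"
  shows "mdeg m = (\<Sum>i\<in>K. Poly_Mapping.lookup m i)"
  unfolding mdeg_def by (rule sum.mono_neutral_left) (use assms in \<open>auto simp: in_keys_iff\<close>)

lemma mdeg_add: "mdeg (a + b) = mdeg a + mdeg b"
proof -
  let ?K = "Poly_Mapping.keys a \<union> Poly_Mapping.keys b"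
  have "mdeg (a + b) = (\<Sum>i\<in>?K. Poly_Mapping.lookup (a + b) i)"
    by (rule mdeg_superset) (simp_all add: keys_add)
  moreover have "mdeg a = (\<Sum>i\<in>?K. Poly_Mapping.lookup a i)" "mdeg b = (\<Sum>i\<in>?K. Poly_Mapping.lookup b i)"
    by (rule mdeg_superset; auto)+
  ultimately show ?thesis by (simp add: lookup_add sum.distrib)
qed

lemma set_mset_mtype: "set_mset (mtype m) = Poly_Mapping.lookup m ` Poly_Mapping.keys m"
  by (simp add: mtype_def)

lemma zero_notin_mtype: "0 \<notin># mtype m"
  by (auto simp: set_mset_mtype in_keys_iff)

lemma size_mtype: "size (mtype m) = card (Poly_Mapping.keys m)"
  by (simp add: mtype_def)

lemma mtype_0: "mtype 0 = {#}"
  by (simp add: mtype_def)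

lemma mtype_eq_empty_iff: "mtype m = {#} \<longleftrightarrow> m = 0"
  by (simp add: mtype_def mset_set_empty_iff)

lemma mtype_map_key:
  assumes "bij \<pi>"
  shows "mtype (Poly_Mapping.map_key \<pi> m) = mtype m"
proof -
  have inj: "inj \<pi>" and surj: "surj \<pi>" using assms by (auto simp: bij_def)
  have "mset_set (Poly_Mapping.keys m) = mset_set (\<pi> ` (\<pi> -` Poly_Mapping.keys m))"
    using surj by (simp add: surj_image_vimage_eq)
  also have "\<dots> = image_mset \<pi> (mset_set (\<pi> -` Poly_Mapping.keys m))"
    by (rule image_mset_mset_set[symmetric]) (use inj in \<open>auto simp: inj_on_def\<close>)
  finally show ?thesis
    by (simp add: mtype_def keys_map_key[OF inj] map_key.rep_eq[OF inj] multiset.map_comp o_def)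
qed

lemma mtype_superset:
  assumes "finite K" "Poly_Mapping.keys m \<subseteq> K"
  shows "image_mset (Poly_Mapping.lookup m) (mset_set K) =
         mtype m + replicate_mset (card (K - Poly_Mapping.keys m)) 0"
proof -
  have "mset_set K = mset_set (Poly_Mapping.keys m) + mset_set (K - Poly_Mapping.keys m)"
    using assms by (subst mset_set_Union[symmetric]) (auto intro!: arg_cong[of _ _ mset_set])
  moreover have "image_mset (Poly_Mapping.lookup m) (mset_set (K - Poly_Mapping.keys m)) =
      image_mset (\<lambda>_. 0) (mset_set (K - Poly_Mapping.keys m))"
    by (rule image_mset_cong) (use assms in \<open>auto simp: in_keys_iff\<close>)
  ultimately show ?thesis
    by (simp add: mtype_def image_mset_const_eq)
qed

text \<open>Types classify monomials up to permutation of the variables: on the union of the two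
  supports, padded with zeros, equal multisets of exponents give a matching permutation, which
  extends by the identity.\<close>

lemma mtype_eq_imp_map_key:
  assumes "mtype m = mtype m'"
  shows "\<exists>\<pi>. bij \<pi> \<and> Poly_Mapping.map_key \<pi> m' = m"
proof -
  let ?K = "Poly_Mapping.keys m \<union> Poly_Mapping.keys m'"
  \<comment> \<open>The supports have equal size, so both monomials receive the same number of
    padding zeros.\<close>
  have "card (?K - Poly_Mapping.keys m) = card (?K - Poly_Mapping.keys m')"
    using arg_cong[OF assms, of size] by (simp add: size_mtype card_Diff_subset)
  then have "image_mset (Poly_Mapping.lookup m) (mset_set ?K) = image_mset (Poly_Mapping.lookup m') (mset_set ?K)"
    using assms by (simp add: mtype_superset)
  from image_mset_eq_implies_permutes[OF _ this]
  obtain p where p: "p permutes ?K" "\<forall>x\<in>?K. Poly_Mapping.lookup m x = Poly_Mapping.lookup m' (p x)"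
    by auto
  have inj: "inj p" and bij: "bij p" using p(1) by (auto simp: permutes_inj permutes_bij)
  have "Poly_Mapping.lookup m' (p x) = Poly_Mapping.lookup m x" for x
  proof (cases "x \<in> ?K")
    case False
    then have "p x = x" using p(1) by (simp add: permutes_def)
    with False show ?thesis by (simp add: in_keys_iff)
  qed (use p in simp)
  then have "Poly_Mapping.map_key p m' = m"
    by (intro poly_mapping_eqI) (simp add: map_key.rep_eq[OF inj])
  with bij show ?thesis by blast
qed

lemma mtype_add_single:
  assumes "x > 0"
  shows "mtype (m + Poly_Mapping.single i x) = add_mset (Poly_Mapping.lookup m i + x)
           (if i \<in> Poly_Mapping.keys m then mtype m - {#Poly_Mapping.lookup m i#} else mtype m)"
proof -
  let ?s = "m + Poly_Mapping.single i x" and ?K = "Poly_Mapping.keys m - {i}"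
  have keys: "Poly_Mapping.keys ?s = insert i ?K"
    using assms by (auto simp: in_keys_iff lookup_add lookup_single when_def split: if_splits)
  have "mtype ?s = add_mset (Poly_Mapping.lookup m i + x) (image_mset (Poly_Mapping.lookup ?s) (mset_set ?K))"
    unfolding mtype_def keys by (subst mset_set.insert) (auto simp: lookup_add)
  also have "image_mset (Poly_Mapping.lookup ?s) (mset_set ?K) = image_mset (Poly_Mapping.lookup m) (mset_set ?K)"
    by (rule image_mset_cong) (auto simp: lookup_add lookup_single when_def)
  also have "\<dots> = (if i \<in> Poly_Mapping.keys m then mtype m - {#Poly_Mapping.lookup m i#} else mtype m)"
    by (auto simp: mtype_def mset_set_Diff image_mset_Diff)
  finally show ?thesis .
qed

text \<open>A fresh variable is always available for the next part. The monomials obtained serve as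
  representatives at which coefficients of symmetric functions are read off.\<close>

lemma ex_mtype:
  assumes "0 \<notin># X"
  shows "\<exists>m. mtype m = X"
  using assms
proof (induction X)
  case empty
  show ?case using mtype_0 by blast
next
  case (add x X)
  then obtain m where m: "mtype m = X" by auto
  obtain i where "i \<notin> Poly_Mapping.keys m"
    using ex_new_if_finite[OF infinite_UNIV_nat] by (metis finite_keys)
  then have "mtype (m + Poly_Mapping.single i x) = add_mset x X"
    using add.prems m by (simp add: mtype_add_single in_keys_iff)
  then show ?case by blast
qed

section \<open>Closure of the symmetric functions under the algebra operations\<close>

lemma symfuns_mtype_cong:
  assumes "f \<in> symfuns" "mtype m = mtype m'"
  shows "f m = f m'"
proof -
  obtain \<pi> where "bij \<pi>" "Poly_Mapping.map_key \<pi> m' = m"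
    using mtype_eq_imp_map_key[OF assms(2)] by blast
  then show ?thesis using assms(1) by (auto simp: symfuns_def)
qed

lemma msym_in_symfuns: "msym X \<in> symfuns"
  by (auto simp: symfuns_def msym_def mtype_map_key mdeg_eq_sum_mset split: if_splits intro!: exI[of _ "sum_mset X"])

lemma series_scale_in_symfuns: "f \<in> symfuns \<Longrightarrow> series_scale c f \<in> symfuns"
  unfolding symfuns_def series_scale_def by auto (metis mult_zero_right)

lemma series_add_in_symfuns:
  assumes "f \<in> symfuns" "g \<in> symfuns"
  shows "series_add f g \<in> symfuns"
proof -
  obtain d d' where "\<And>m. f m \<noteq> 0 \<Longrightarrow> mdeg m \<le> d" "\<And>m. g m \<noteq> 0 \<Longrightarrow> mdeg m \<le> d'"
    using assms unfolding symfuns_def by auto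
  then have "\<forall>m. series_add f g m \<noteq> 0 \<longrightarrow> mdeg m \<le> max d d'"
    unfolding series_add_def by (metis add_0 le_max_iff_disj)
  with assms show ?thesis by (auto simp: symfuns_def series_add_def)
qed

lemma map_key_inv:
  assumes "bij \<pi>"
  shows "Poly_Mapping.map_key (inv \<pi>) (Poly_Mapping.map_key \<pi> m) = m"
    and "Poly_Mapping.map_key \<pi> (Poly_Mapping.map_key (inv \<pi>) m) = m"
proof -
  have inj: "inj \<pi>" "inj (inv \<pi>)" "surj \<pi>" using assms by (auto simp: bij_def bij_imp_bij_inv inj_imp_surj_inv surj_imp_inj_inv)
  show "Poly_Mapping.map_key (inv \<pi>) (Poly_Mapping.map_key \<pi> m) = m"
    by (intro poly_mapping_eqI) (simp add: map_key.rep_eq inj surj_f_inv_f)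
  show "Poly_Mapping.map_key \<pi> (Poly_Mapping.map_key (inv \<pi>) m) = m"
    by (intro poly_mapping_eqI) (simp add: map_key.rep_eq inj inv_f_f)
qed

lemma series_mult_in_symfuns:
  assumes "f \<in> symfuns" "g \<in> symfuns"
  shows "series_mult f g \<in> symfuns"
proof -
  obtain d d' where d: "\<And>m. f m \<noteq> 0 \<Longrightarrow> mdeg m \<le> d" "\<And>m. g m \<noteq> 0 \<Longrightarrow> mdeg m \<le> d'"
    using assms unfolding symfuns_def by auto
  have "mdeg m \<le> d + d'" if "series_mult f g m \<noteq> 0" for m
  proof -
    obtain ab where "ab \<in> {(a, b). a + b = m}" "(case ab of (a, b) \<Rightarrow> f a * g b) \<noteq> 0"
      using \<open>series_mult f g m \<noteq> 0\<close> unfolding series_mult_def by (rule sum.not_neutral_contains_not_neutral)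
    then obtain a b where "a + b = m" "f a * g b \<noteq> 0" by auto
    then have "f a \<noteq> 0" "g b \<noteq> 0" by auto
    then have "mdeg a \<le> d" "mdeg b \<le> d'" by (simp_all add: d)
    then show ?thesis using \<open>a + b = m\<close> by (auto simp: mdeg_add)
  qed
  moreover have "series_mult f g (Poly_Mapping.map_key \<pi> m) = series_mult f g m" if \<pi>: "bij \<pi>" for \<pi> m
  proof -
    have inj: "inj \<pi>" "inj (inv \<pi>)" using \<pi> by (auto simp: bij_def bij_imp_bij_inv surj_imp_inj_inv)
    have sym: "f (Poly_Mapping.map_key \<pi> a) = f a" "g (Poly_Mapping.map_key \<pi> a) = g a" for a
      using assms \<pi> by (auto simp: symfuns_def)
    \<comment> \<open>The splittings of a permuted monomial are the permuted splittings of the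
      original one.\<close>
    show ?thesis unfolding series_mult_def
      by (rule sum.reindex_bij_witness[where
            i = "\<lambda>(a, b). (Poly_Mapping.map_key \<pi> a, Poly_Mapping.map_key \<pi> b)" and
            j = "\<lambda>(a, b). (Poly_Mapping.map_key (inv \<pi>) a, Poly_Mapping.map_key (inv \<pi>) b)"])
         (auto simp: map_key_inv[OF \<pi>] sym map_key_plus[OF inj(1), symmetric] map_key_plus[OF inj(2), symmetric],
           metis sym map_key_inv[OF \<pi>])
  qed
  ultimately show ?thesis by (auto simp: symfuns_def)
qed

subsection \<open>Multiplication by power sums\<close>

definition mfact :: "nat multiset \<Rightarrow> nat" where
  "mfact X = (\<Prod>x\<in>set_mset X. fact (count X x))"

lemma mfact_superset:
  assumes "finite K" "set_mset X \<subseteq> K"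
  shows "mfact X = (\<Prod>x\<in>K. fact (count X x))"
  unfolding mfact_def
  by (rule prod.mono_neutral_left) (use assms in \<open>auto simp: not_in_iff\<close>)

lemma mfact_empty [simp]: "mfact {#} = 1"
  by (simp add: mfact_def)

lemma mfact_add_mset: "mfact (add_mset x X) = mfact X * Suc (count X x)"
proof -
  let ?K = "set_mset X - {x}"
  have "mfact (add_mset x X) = (\<Prod>y\<in>insert x ?K. fact (count (add_mset x X) y))"
    by (rule mfact_superset) auto
  also have "\<dots> = fact (Suc (count X x)) * (\<Prod>y\<in>?K. fact (count X y))"
    by (subst prod.insert) (auto intro!: prod.cong)
  also have "\<dots> = (\<Prod>y\<in>insert x ?K. fact (count X y)) * Suc (count X x)"
    by (subst prod.insert) (auto simp: algebra_simps)
  also have "(\<Prod>y\<in>insert x ?K. fact (count X y)) = mfact X"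
    by (rule mfact_superset[symmetric]) auto
  finally show ?thesis .
qed

lemma mult_fact_eq_mfact: "mult_fact la = mfact (mset la)"
  by (simp add: mult_fact_def mfact_def count_mset)

text \<open>With this normalization a product with a power sum has no multiplicity coefficients:
  every part of \<open>X\<close>, repeated parts included, contributes one summand.\<close>

definition augm :: "nat multiset \<Rightarrow> 'a::comm_ring_1 series" where
  "augm X = series_scale (of_nat (mfact X)) (msym X)"

lemma aug_monomial_sym_eq_augm: "aug_monomial_sym la = augm (mset la)"
  by (simp add: aug_monomial_sym_def augm_def mult_fact_eq_mfact monomial_sym_eq_msym)

lemma augm_in_symfuns: "augm X \<in> symfuns"
  by (simp add: augm_def series_scale_in_symfuns msym_in_symfuns)

lemma power_sum_eq_msym:
  assumes "k > 0"
  shows "power_sum k = msym {#k#}"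
proof -
  have "(\<exists>i. m = Poly_Mapping.single i k) \<longleftrightarrow> mtype m = {#k#}" for m
  proof
    assume "mtype m = {#k#}"
    then have "card (Poly_Mapping.keys m) = 1" by (metis size_mtype size_single)
    then obtain i where i: "Poly_Mapping.keys m = {i}" by (auto simp: card_1_singleton_iff)
    then have "Poly_Mapping.lookup m i = k" using \<open>mtype m = {#k#}\<close> by (simp add: mtype_def)
    moreover have "Poly_Mapping.lookup m j = 0" if "j \<noteq> i" for j
      using i that by (metis in_keys_iff singletonD)
    ultimately have "m = Poly_Mapping.single i k"
      by (intro poly_mapping_eqI) (auto simp: lookup_single when_def)
    then show "\<exists>i. m = Poly_Mapping.single i k" ..
  qed (use assms in \<open>auto simp: mtype_def\<close>)
  then show ?thesis by (simp add: power_sum_def msym_def)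
qed

lemma mtype_diff_single:
  assumes "k > 0" "k \<le> Poly_Mapping.lookup m i"
  shows "mtype (m - Poly_Mapping.single i k) =
    (if Poly_Mapping.lookup m i = k then mtype m - {#k#}
     else add_mset (Poly_Mapping.lookup m i - k) (mtype m - {#Poly_Mapping.lookup m i#}))"
proof -
  let ?a = "m - Poly_Mapping.single i k"
  have m: "m = ?a + Poly_Mapping.single i k"
    using assms by (intro poly_mapping_eqI) (auto simp: lookup_add lookup_minus lookup_single when_def)
  have ai: "Poly_Mapping.lookup ?a i = Poly_Mapping.lookup m i - k" by (simp add: lookup_minus)
  have "mtype m = add_mset (Poly_Mapping.lookup m i)
      (if i \<in> Poly_Mapping.keys ?a then mtype ?a - {#Poly_Mapping.lookup ?a i#} else mtype ?a)"
    by (subst m, subst mtype_add_single[OF assms(1)]) (use assms(2) ai in simp)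
  moreover have "i \<in> Poly_Mapping.keys ?a \<longleftrightarrow> Poly_Mapping.lookup m i \<noteq> k"
    using assms(2) by (auto simp: in_keys_iff ai)
  moreover have "Poly_Mapping.lookup ?a i \<in># mtype ?a" if "i \<in> Poly_Mapping.keys ?a"
    using that by (simp add: set_mset_mtype)
  ultimately show ?thesis by (auto simp: ai)
qed

text \<open>Only splittings whose first factor is the k-th power of a single variable contribute,
  and distinct variables give distinct splittings.\<close>

lemma series_mult_power_sum:
  assumes "k > 0"
  shows "series_mult (power_sum k) g m =
    (\<Sum>i | i \<in> Poly_Mapping.keys m \<and> k \<le> Poly_Mapping.lookup m i. g (m - Poly_Mapping.single i k))"
proof -
  let ?I = "{i. i \<in> Poly_Mapping.keys m \<and> k \<le> Poly_Mapping.lookup m i}"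
  let ?h = "\<lambda>i. (Poly_Mapping.single i k, m - Poly_Mapping.single i k)"
  have sub: "?h ` ?I \<subseteq> {(a, b). a + b = m}"
    by (auto intro!: poly_mapping_eqI simp: lookup_add lookup_minus lookup_single when_def)
  have "series_mult (power_sum k) g m = (\<Sum>(a, b)\<in>?h ` ?I. power_sum k a * g b)"
    unfolding series_mult_def
  proof (rule sum.mono_neutral_right[OF finite_monomial_splittings sub], intro ballI)
    fix ab assume "ab \<in> {(a, b). a + b = m} - ?h ` ?I"
    then obtain a b where ab: "(a, b) \<notin> ?h ` ?I" "m = a + b" "ab = (a, b)" by blast
    have "power_sum k a * g b = 0"
    proof (rule ccontr)
      assume "power_sum k a * g b \<noteq> 0"
      then obtain i where i: "a = Poly_Mapping.single i k"
        by (auto simp: power_sum_def split: if_splits)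
      then have "(a, b) = ?h i" "i \<in> ?I" using ab(2) assms by (auto simp: in_keys_iff lookup_add)
      then have "(a, b) \<in> ?h ` ?I" by (rule image_eqI)
      with ab(1) show False ..
    qed
    with ab(3) show "(case ab of (a, b) \<Rightarrow> power_sum k a * g b) = 0" by simp
  qed
  also have "\<dots> = (\<Sum>i\<in>?I. g (m - Poly_Mapping.single i k))"
  proof -
    have "i = j" if "Poly_Mapping.single i k = Poly_Mapping.single j k" for i j :: nat
      using arg_cong[OF that, of "\<lambda>p. Poly_Mapping.lookup p i"] assms
      by (auto simp: lookup_single when_def split: if_splits)
    then have "inj_on ?h ?I" by (auto simp: inj_on_def)
    then show ?thesis by (subst sum.reindex) (auto simp: power_sum_def intro!: sum.cong)
  qed
  finally show ?thesis .
qed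

lemma sum_mset_eq_sum_count:
  assumes "finite K" "set_mset M \<subseteq> K"
  shows "(\<Sum>x\<in>#M. f x) = (\<Sum>x\<in>K. of_nat (count M x) * (f x :: 'b::comm_semiring_1))"
  using assms(2)
proof (induction M)
  case (add y M)
  have "(\<Sum>x\<in>K. of_nat (count (add_mset y M) x) * f x) =
        (\<Sum>x\<in>K. (if x = y then f x else 0) + of_nat (count M x) * f x)"
    by (rule sum.cong) (auto simp: algebra_simps)
  also have "\<dots> = f y + (\<Sum>x\<in>K. of_nat (count M x) * f x)"
    using add.prems assms(1) by (simp add: sum.distrib sum.delta)
  finally show ?case using add by simp
qed simp

text \<open>Dividing \<open>m\<close> by the k-th power of a variable either removes a part equal to
  \<open>k\<close> or shrinks a part c > k to b = c - k. Grouping the variables by exponent turns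
  the count into multiplicities, which the factors \<open>mfact\<close> absorb.\<close>

lemma power_sum_count:
  assumes k: "k > 0" and X: "0 \<notin># X"
  shows "(\<Sum>i | i \<in> Poly_Mapping.keys m \<and> k \<le> Poly_Mapping.lookup m i.
            if mtype (m - Poly_Mapping.single i k) = X then mfact X else 0) =
         (if mtype m = add_mset k X then mfact (mtype m) else 0) +
         (\<Sum>b\<in>#X. if mtype m = add_mset (b + k) (X - {#b#}) then mfact (mtype m) else 0)"
    (is "?L = ?R1 + ?R2")
proof -
  let ?Y = "mtype m"
  let ?g1 = "\<lambda>c. if c = k \<and> ?Y - {#k#} = X then mfact X else 0"
  let ?g2 = "\<lambda>c. if c > k \<and> add_mset (c - k) (?Y - {#c#}) = X then mfact X else 0"
  have "?L = (\<Sum>i\<in>Poly_Mapping.keys m. ?g1 (Poly_Mapping.lookup m i) + ?g2 (Poly_Mapping.lookup m i))"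
    using k by (intro sum.mono_neutral_cong_left) (auto simp: mtype_diff_single)
  also have "\<dots> = (\<Sum>c\<in>#?Y. ?g1 c) + (\<Sum>c\<in>#?Y. ?g2 c)"
    by (simp add: sum.distrib mtype_def sum_unfold_sum_mset multiset.map_comp o_def)
  also have "(\<Sum>c\<in>#?Y. ?g1 c) = ?R1"
  proof -
    have "(\<Sum>c\<in>#?Y. ?g1 c) = (\<Sum>c\<in>insert k (set_mset ?Y). count ?Y c * ?g1 c)"
      by (subst sum_mset_eq_sum_count[where K = "insert k (set_mset ?Y)"]) auto
    also have "\<dots> = count ?Y k * ?g1 k"
      by (subst sum.insert_remove) (auto intro: sum.neutral)
    also have "\<dots> = ?R1"
    proof (cases "?Y = add_mset k X")
      case False
      then show ?thesis by (cases "k \<in># ?Y") (auto simp: not_in_iff)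
    qed (auto simp: mfact_add_mset)
    finally show ?thesis .
  qed
  also have "(\<Sum>c\<in>#?Y. ?g2 c) = ?R2"
  proof -
    let ?C = "{c \<in> set_mset ?Y. c > k \<and> add_mset (c - k) (?Y - {#c#}) = X}"
    let ?B = "{b \<in> set_mset X. ?Y = add_mset (b + k) (X - {#b#})}"
    have "(\<Sum>c\<in>#?Y. ?g2 c) = (\<Sum>c\<in>?C. count ?Y c * mfact X)"
      by (subst sum_mset_eq_sum_count[where K = "set_mset ?Y"]) (auto intro!: sum.mono_neutral_cong_right split: if_splits)
    also have "\<dots> = (\<Sum>b\<in>?B. count X b * mfact ?Y)"
    proof (rule sum.reindex_bij_witness[where i = "\<lambda>b. b + k" and j = "\<lambda>c. c - k"])
      fix c assume c: "c \<in> ?C"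
      then obtain Z where Y: "?Y = add_mset c Z" by (auto dest: multi_member_split)
      with c have XZ: "X = add_mset (c - k) Z" by auto
      show "c - k \<in> ?B" using c Y XZ by auto
      \<comment> \<open>\<open>X\<close> and \<open>?Y\<close> each add one part to the same
        \<open>Z\<close>, so by \<open>mfact_add_mset\<close> both products equal
        \<open>mfact Z\<close> times the two raised multiplicities.\<close>
      show "count X (c - k) * mfact ?Y = count ?Y c * mfact X"
        unfolding Y XZ mfact_add_mset by (simp add: algebra_simps)
    next
      fix b assume b: "b \<in> ?B"
      then obtain Z where "X = add_mset b Z" by (auto dest: multi_member_split)
      with b X show "b + k \<in> ?C" by auto
    qed auto
    also have "\<dots> = ?R2"
      by (subst sum_mset_eq_sum_count[where K = "set_mset X"]) (auto intro!: sum.mono_neutral_cong_left split: if_splits)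
    finally show ?thesis .
  qed
  finally show ?thesis .
qed

lemma power_sum_mult_augm:
  assumes "k > 0" "0 \<notin># X"
  shows "series_mult (power_sum k) (augm X) m =
         (augm (add_mset k X) m :: 'a::comm_ring_1) + (\<Sum>b\<in>#X. augm (add_mset (b + k) (X - {#b#})) m)"
proof -
  have augm: "augm X m = of_nat (if mtype m = X then mfact X else 0)" for X m
    by (simp add: augm_def series_scale_def msym_def)
  \<comment> \<open>The same coefficient written through the type of \<open>m\<close>, which is the
    form on the right of \<open>power_sum_count\<close>; all coefficients are images of naturals, so
    the identity is a count.\<close>
  have augm': "augm X m = of_nat (if mtype m = X then mfact (mtype m) else 0)" for X m
    by (simp add: augm_def series_scale_def msym_def)
  have "series_mult (power_sum k) (augm X) m =
    (of_nat (\<Sum>i | i \<in> Poly_Mapping.keys m \<and> k \<le> Poly_Mapping.lookup m i.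
            if mtype (m - Poly_Mapping.single i k) = X then mfact X else 0) :: 'a)"
    unfolding series_mult_power_sum[OF assms(1)] augm of_nat_sum ..
  moreover have "of_nat (\<Sum>b\<in>#X. f b) = (\<Sum>b\<in>#X. of_nat (f b) :: 'a::comm_ring_1)" for f :: "nat \<Rightarrow> nat"
    by (induction X) simp_all
  ultimately show ?thesis
    by (simp only: power_sum_count[OF assms] augm' of_nat_add)
qed

lemma msym_empty: "msym {#} = series_one"
  by (simp add: msym_def series_one_def mtype_eq_empty_iff)

lemma mfact_replicate: "mfact (replicate_mset n x) = fact n"
  by (induction n) (simp_all add: mfact_add_mset)

lemma elem_sym_eq_msym: "elem_sym n = msym (replicate_mset n 1)"
proof -
  have "mdeg m = n \<and> (\<forall>i. Poly_Mapping.lookup m i \<le> 1) \<longleftrightarrow> mtype m = replicate_mset n 1" for m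
  proof (cases "\<forall>i. Poly_Mapping.lookup m i \<le> 1")
    case True
    then have "Poly_Mapping.lookup m i = 1" if "i \<in> Poly_Mapping.keys m" for i
      using that by (metis in_keys_iff le_antisym less_one not_le)
    then have "mtype m = image_mset (\<lambda>_. 1) (mset_set (Poly_Mapping.keys m))"
      unfolding mtype_def by (intro image_mset_cong) auto
    then have "mtype m = replicate_mset (card (Poly_Mapping.keys m)) 1"
      by (simp add: image_mset_const_eq)
    with True show ?thesis
      by (simp add: mdeg_eq_sum_mset) (metis size_replicate_mset)
  next
    case False
    then obtain i where "Poly_Mapping.lookup m i > 1" by (auto simp: not_le)
    then have "Poly_Mapping.lookup m i \<in># mtype m" by (auto simp: set_mset_mtype in_keys_iff)
    with \<open>Poly_Mapping.lookup m i > 1\<close> have "mtype m \<noteq> replicate_mset n 1" by (auto simp: in_replicate_mset split: if_splits)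
    with False show ?thesis by blast
  qed
  then show ?thesis by (simp add: elem_sym_def msym_def)
qed

section \<open>Algebra homomorphisms on symmetric functions and Newton's identities\<close>

locale symfun_hom =
  fixes \<phi> :: "'a::comm_ring_1 series \<Rightarrow> 'a"
  assumes hom: "symfun_algebra_hom \<phi>"
begin

lemma hom_one: "\<phi> series_one = 1"
  and hom_add: "f \<in> symfuns \<Longrightarrow> g \<in> symfuns \<Longrightarrow> \<phi> (series_add f g) = \<phi> f + \<phi> g"
  and hom_mult: "f \<in> symfuns \<Longrightarrow> g \<in> symfuns \<Longrightarrow> \<phi> (series_mult f g) = \<phi> f * \<phi> g"
  and hom_scale: "f \<in> symfuns \<Longrightarrow> \<phi> (series_scale c f) = c * \<phi> f"
  using hom by (auto simp: symfun_algebra_hom_def)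

text \<open>Membership and value share one induction, because \<open>hom_add\<close> applies only to
  members of \<open>symfuns\<close>.\<close>

lemma hom_sum_mset:
  assumes "\<And>x. x \<in># X \<Longrightarrow> f x \<in> symfuns"
  shows "(\<lambda>m. \<Sum>x\<in>#X. f x m) \<in> symfuns \<and> \<phi> (\<lambda>m. \<Sum>x\<in>#X. f x m) = (\<Sum>x\<in>#X. \<phi> (f x))"
  using assms
proof (induction X)
  case empty
  have "(\<lambda>_. 0) = series_scale 0 (msym {#} :: 'a series)"
    by (simp add: series_scale_def)
  then show ?case
    by (simp add: series_scale_in_symfuns msym_in_symfuns hom_scale)
next
  case (add y X)
  have "(\<lambda>m. \<Sum>x\<in>#add_mset y X. f x m) = series_add (f y) (\<lambda>m. \<Sum>x\<in>#X. f x m)"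
    by (simp add: series_add_def)
  with add show ?case by (simp add: series_add_in_symfuns hom_add)
qed

lemma hom_power_sum_augm:
  assumes "k > 0" "0 \<notin># X"
  shows "\<phi> (power_sum k) * \<phi> (augm X) =
         \<phi> (augm (add_mset k X)) + (\<Sum>b\<in>#X. \<phi> (augm (add_mset (b + k) (X - {#b#}))))"
proof -
  let ?g = "(\<lambda>m. \<Sum>b\<in>#X. augm (add_mset (b + k) (X - {#b#})) m) :: 'a series"
  have g: "?g \<in> symfuns" "\<phi> ?g = (\<Sum>b\<in>#X. \<phi> (augm (add_mset (b + k) (X - {#b#}))))"
    using hom_sum_mset[of X "\<lambda>b. augm (add_mset (b + k) (X - {#b#}))"] by (simp_all add: augm_in_symfuns)
  have "series_mult (power_sum k) (augm X) = series_add (augm (add_mset k X)) ?g"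
    by (rule ext) (simp add: series_add_def power_sum_mult_augm[OF assms])
  moreover have "\<phi> (series_mult (power_sum k) (augm X)) = \<phi> (power_sum k) * \<phi> (augm X)"
    by (rule hom_mult) (simp_all add: power_sum_eq_msym[OF assms(1)] msym_in_symfuns augm_in_symfuns)
  ultimately show ?thesis by (simp add: hom_add augm_in_symfuns g)
qed

lemma hom_augm: "\<phi> (augm X) = of_nat (mfact X) * \<phi> (msym X)"
  by (simp add: augm_def hom_scale msym_in_symfuns)

lemma hom_augm_single: "k > 0 \<Longrightarrow> \<phi> (augm {#k#}) = \<phi> (power_sum k)"
  by (simp add: hom_augm mfact_add_mset power_sum_eq_msym)

lemma hom_augm_ones: "\<phi> (augm (replicate_mset n 1)) = of_nat (fact n) * \<phi> (elem_sym n)"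
  by (simp add: hom_augm mfact_replicate elem_sym_eq_msym)

end

locale field_symfun_hom = symfun_hom \<phi> for \<phi> :: "'a::field_char_0 series \<Rightarrow> 'a"
begin

text \<open>A product of a power sum and an elementary function is a sum of two neighbouring hook
  functions, so the alternating sum telescopes. For j > 0, \<open>H j\<close> is the value of the
  monomial function of the hook with arm part j + 1 and n - j ones; for j = 0 the extra part is
  itself a one, and \<open>H 0\<close> is n + 1 times the value of the elementary function of degree
  n + 1.\<close>

lemma newton:
  "(\<Sum>j\<le>n. (-1) ^ j * \<phi> (power_sum (Suc j)) * \<phi> (elem_sym (n - j))) =
   of_nat (Suc n) * \<phi> (elem_sym (Suc n))"
proof -
  define H where "H j = \<phi> (augm (add_mset (Suc j) (replicate_mset (n - j) 1))) / fact (n - j)" for j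
  have elem: "\<phi> (elem_sym k) = \<phi> (augm (replicate_mset k 1)) / fact k"
    for k using hom_augm_ones[of k] by simp
  have step: "\<phi> (power_sum (Suc j)) * \<phi> (elem_sym (n - j)) = H j + H (Suc j)" if "j < n" for j
  proof -
    obtain i where n: "n = Suc (i + j)" using less_imp_Suc_add[OF \<open>j < n\<close>] by (auto simp: add.commute)
    have "\<phi> (power_sum (Suc j)) * \<phi> (augm (replicate_mset (Suc i) 1)) =
      \<phi> (augm (add_mset (Suc j) (replicate_mset (Suc i) 1))) +
      (\<Sum>b\<in>#replicate_mset (Suc i) 1. \<phi> (augm (add_mset (b + Suc j) (replicate_mset (Suc i) 1 - {#b#}))))"
      by (rule hom_power_sum_augm) simp_all
    also have "(\<Sum>b\<in>#replicate_mset (Suc i) 1. \<phi> (augm (add_mset (b + Suc j) (replicate_mset (Suc i) 1 - {#b#})))) =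
      of_nat (Suc i) * \<phi> (augm (add_mset (Suc (Suc j)) (replicate_mset i 1)))"
      by (subst image_replicate_mset, subst sum_mset_replicate_mset) simp
    finally show ?thesis
      by (simp add: H_def elem n field_simps del: of_nat_Suc replicate_mset_Suc)
  qed
  \<comment> \<open>At j = n the second factor is 1, so only one hook remains; it cancels the end of
    the telescope.\<close>
  have last: "\<phi> (power_sum (Suc n)) * \<phi> (elem_sym 0) = H n"
    by (simp add: H_def hom_augm_single elem_sym_eq_msym msym_empty hom_one)
  have telescope: "(\<Sum>j<k. (-1) ^ j * (H j + H (Suc j))) = H 0 - (-1) ^ k * H k" for k
    by (induction k) (simp_all add: algebra_simps)
  have "(\<Sum>j\<le>n. (-1) ^ j * \<phi> (power_sum (Suc j)) * \<phi> (elem_sym (n - j))) =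
     (\<Sum>j<n. (-1) ^ j * (H j + H (Suc j))) + (-1) ^ n * H n"
    by (simp add: step last mult.assoc flip: lessThan_Suc_atMost)
  also have "\<dots> = H 0" by (simp add: telescope)
  also have "\<dots> = of_nat (Suc n) * \<phi> (elem_sym (Suc n))"
    using hom_augm_ones[of "Suc n"] by (simp add: H_def field_simps)
  finally show ?thesis .
qed

end

subsection \<open>Specialized power sums\<close>

lemma qvar_neq_one: "1 - qvar \<noteq> 0"
proof -
  have "1 - qvar = to_fract (1 - [:0, 1:])" by (simp add: qvar_def)
  then show ?thesis by (simp add: pCons_eq_iff one_pCons)
qed

lemma to_fract_of_nat: "to_fract (of_nat n) = of_nat n"
  by (induction n) simp_all

lemma to_fract_power: "to_fract (x ^ n) = to_fract x ^ n"
  by (induction n) simp_all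

lemma to_fract_smult_inverse:
  fixes P :: "rat poly"
  shows "to_fract (smult (1 / of_nat n) P) = to_fract P / of_nat n"
\<comment> \<open>For n = 0 both sides vanish, since division by zero yields zero.\<close>
proof (cases "n = 0")
  case False
  then have "P = of_nat n * smult (1 / of_nat n) P" by (simp add: of_nat_poly field_simps)
  from arg_cong[OF this, of to_fract] False show ?thesis
    by (simp only: to_fract_mult to_fract_of_nat) simp
qed simp

text \<open>The q-integer of k + 1, not of k; the shift matches
  \<open>power_sum (Suc k)\<close>.\<close>

definition qnum :: "nat \<Rightarrow> rat poly" where
  "qnum k = (\<Sum>i\<le>k. monom 1 i)"

lemma qnum_geometric: "(1 - qvar) * to_fract (qnum k) = 1 - qvar ^ Suc k"
proof -
  have "(1 - [:0, 1:]) * qnum k = 1 - [:0, 1:] ^ Suc k"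
    using sum_gp_basic[of "[:0, 1:] :: rat poly" k] by (simp add: qnum_def monom_altdef)
  from arg_cong[OF this, of to_fract] show ?thesis
    by (simp add: qvar_def to_fract_power del: power_Suc)
qed

lemma degree_qnum: "degree (qnum k) \<le> k"
  unfolding qnum_def by (rule degree_sum_le) (auto intro: order_trans[OF degree_monom_le])

lemma coeff_qnum: "coeff (qnum k) i = (if i \<le> k then 1 else 0)"
  by (simp add: qnum_def coeff_sum)

lemma coeff_mult_le_degree_sum:
  fixes p q :: "'a::comm_semiring_0 poly"
  assumes "degree p \<le> a" "degree q \<le> b"
  shows "coeff (p * q) (a + b) = coeff p a * coeff q b"
proof (cases "degree p = a \<and> degree q = b")
  case True
  then show ?thesis using coeff_mult_degree_sum[of p q] by simp
next
  case False
  then have "degree (p * q) < a + b" using assms degree_mult_le[of p q] by linarith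
  moreover have "coeff p a = 0 \<or> coeff q b = 0" using False assms by (auto simp: coeff_eq_0)
  ultimately show ?thesis by (auto simp: coeff_eq_0)
qed

text \<open>Pairs inside either block plus pairs across. The cross term makes the degree estimate in
  \<open>power_sum_poly\<close> strict.\<close>

lemma choose_two_add: "(m + n) choose 2 = (m choose 2) + (n choose 2) + m * n"
proof -
  have two: "2 * (k choose 2) = k * (k - 1)" for k :: nat
    by (cases k) (simp_all add: choose_two)
  show ?thesis
  proof (cases m; cases n)
    fix m' n' assume "m = Suc m'" "n = Suc n'"
    then have "2 * ((m + n) choose 2) = 2 * ((m choose 2) + (n choose 2) + m * n)"
      unfolding distrib_left two by (simp add: algebra_simps)
    then show ?thesis by simp
  qed simp_all
qed

locale specialization =
  fixes \<phi> :: "ratfun series \<Rightarrow> ratfun"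
  assumes spec: "is_specialization \<phi>"
begin

sublocale field_symfun_hom \<phi>
  by unfold_locales (use spec in \<open>simp add: is_specialization_def\<close>)

lemma elem_sym_val: "\<phi> (elem_sym n) = qvar ^ (n choose 2) / fact n"
  using spec by (simp add: is_specialization_def)

lemma power_sum_recurrence:
  "of_nat (Suc n) * \<phi> (power_sum (Suc (Suc n))) =
   (\<Sum>k\<le>n. (1 - qvar ^ Suc k) * \<phi> (power_sum (Suc k)) * \<phi> (power_sum (Suc (n - k))))"
proof -
  define F where "F = Abs_fps (\<lambda>n. \<phi> (elem_sym n))"
  define G where "G = Abs_fps (\<lambda>n. (-1) ^ n * \<phi> (power_sum (Suc n)))"
  \<comment> \<open>Composition with \<open>Q\<close> is the substitution of qt for t.\<close>
  define Q where "Q = fps_const qvar * fps_X"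
  have Q0: "Q $ 0 = 0" by (simp add: Q_def)
  have scale: "(f oo Q) $ k = qvar ^ k * f $ k" for f k
    by (simp add: Q_def fps_compose_linear)
  have dF: "fps_deriv F = F * G"
    by (subst mult.commute, rule fps_ext)
       (simp add: F_def G_def fps_mult_nth atLeast0AtMost newton del: of_nat_Suc)
  have dF': "fps_deriv F = F oo Q"
  proof (rule fps_ext)
    fix k
    \<comment> \<open>This is where the chosen values enter: (k + 1) times the value of degree k + 1
      is q^k times the value of degree k.\<close>
    have "Suc k choose 2 = k + (k choose 2)" by (simp add: numeral_2_eq_2)
    then show "fps_deriv F $ k = (F oo Q) $ k"
      by (simp add: scale F_def elem_sym_val power_add del: of_nat_Suc)
  qed
  \<comment> \<open>The second derivative of F in two ways: F' = FG gives F(G^2 + G'), while F' =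
    F(qt) gives q F(qt) G(qt) with F(qt) = FG. The constant term 1 of F allows cancelling
    it.\<close>
  have "F * (G * G + fps_deriv G) = fps_deriv (fps_deriv F)"
    by (simp add: dF algebra_simps)
  also have "fps_deriv (fps_deriv F) = fps_deriv (F oo Q)" by (simp only: dF')
  also have "\<dots> = (fps_deriv F oo Q) * fps_const qvar"
    by (subst fps_compose_deriv[OF Q0]) (simp add: Q_def)
  also have "\<dots> = F * G * (G oo Q) * fps_const qvar"
    by (simp only: dF fps_compose_mult_distrib[OF Q0] dF'[symmetric])
  finally have "F * (G * G + fps_deriv G) = F * (fps_const qvar * (G oo Q) * G)"
    by (simp add: algebra_simps)
  moreover have "F \<noteq> 0"
    using elem_sym_val[of 0] by (auto simp: F_def fps_eq_iff intro!: exI[of _ 0])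
  ultimately have "G * G + fps_deriv G = fps_const qvar * (G oo Q) * G" by simp
  then have "fps_deriv G = (fps_const qvar * (G oo Q) - G) * G"
    by (simp add: algebra_simps)
  from arg_cong[OF this, of "\<lambda>f. f $ n"]
  have "of_nat (Suc n) * G $ Suc n = (\<Sum>k\<le>n. (qvar * (qvar ^ k * G $ k) - G $ k) * G $ (n - k))"
    by (subst (asm) fps_mult_nth) (simp add: scale atLeast0AtMost del: of_nat_Suc)
  \<comment> \<open>The signs in \<open>G\<close> multiply to (-1)^n; turning q^(k+1) - 1 into 1 -
    q^(k+1) supplies one more.\<close>
  also have "\<dots> = (-1) ^ Suc n * (\<Sum>k\<le>n. (1 - qvar ^ Suc k) * \<phi> (power_sum (Suc k)) * \<phi> (power_sum (Suc (n - k))))"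
    unfolding sum_distrib_left
  proof (rule sum.cong)
    fix k assume "k \<in> {..n}"
    then have "(-1) ^ n = (-1) ^ k * (-1 :: ratfun) ^ (n - k)" by (simp flip: power_add)
    then show "(qvar * (qvar ^ k * G $ k) - G $ k) * G $ (n - k) =
      (-1) ^ Suc n * ((1 - qvar ^ Suc k) * \<phi> (power_sum (Suc k)) * \<phi> (power_sum (Suc (n - k))))"
      by (simp add: G_def algebra_simps)
  qed simp
  finally show ?thesis by (simp add: G_def mult.left_commute del: of_nat_Suc)
qed

text \<open>Strong induction along the recurrence; 1 - q^(k+1) supplies the missing factor 1 - q and
  leaves \<open>qnum k\<close>. With n = l + 1, only the summand k = l reaches the top degree,
  giving 1/l! and after division by n the claimed 1/n!. All n summands have constant term 1, so
  their average is 1.\<close>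

lemma power_sum_poly:
  "\<exists>P. \<phi> (power_sum (Suc n)) = (1 - qvar) ^ n * to_fract P \<and>
       degree P \<le> n choose 2 \<and> coeff P (n choose 2) = 1 / fact n \<and> coeff P 0 = 1"
proof (induction n rule: less_induct)
  case (less n)
  show ?case
  proof (cases n)
    case 0
    have "\<phi> (power_sum 1) = 1"
      using newton[of 0] by (simp add: elem_sym_val numeral_2_eq_2)
    with 0 show ?thesis by (intro exI[of _ 1]) (simp add: numeral_2_eq_2)
  next
    case (Suc l)
    have "\<forall>k\<in>{..l}. \<exists>P. \<phi> (power_sum (Suc k)) = (1 - qvar) ^ k * to_fract P \<and>
       degree P \<le> k choose 2 \<and> coeff P (k choose 2) = 1 / fact k \<and> coeff P 0 = 1"
      using less.IH Suc by auto
    from bchoice[OF this] obtain P where P: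
      "\<And>k. k \<le> l \<Longrightarrow> \<phi> (power_sum (Suc k)) = (1 - qvar) ^ k * to_fract (P k)"
      "\<And>k. k \<le> l \<Longrightarrow> degree (P k) \<le> k choose 2"
      "\<And>k. k \<le> l \<Longrightarrow> coeff (P k) (k choose 2) = 1 / fact k"
      "\<And>k. k \<le> l \<Longrightarrow> coeff (P k) 0 = 1"
      by auto
    define T where "T k = qnum k * P k * P (l - k)" for k
    define R where "R = smult (1 / of_nat n) (\<Sum>k\<le>l. T k)"
    have deg: "degree (T k) \<le> (Suc k choose 2) + ((l - k) choose 2)" if "k \<le> l" for k
    proof -
      have "degree (T k) \<le> degree (qnum k) + degree (P k) + degree (P (l - k))"
        unfolding T_def by (meson add_mono degree_mult_le order_refl order_trans)
      also have "\<dots> \<le> k + (k choose 2) + ((l - k) choose 2)"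
        using that by (intro add_mono P(2) degree_qnum) auto
      finally show ?thesis by (simp add: numeral_2_eq_2)
    qed
    have deg': "degree (T k) < n choose 2" if "k < l" for k
    proof -
      \<comment> \<open>The cross term is positive because k < l.\<close>
      have "n choose 2 = (Suc k choose 2) + ((l - k) choose 2) + Suc k * (l - k)"
        using choose_two_add[of "Suc k" "l - k"] that Suc by simp
      with deg[of k] that show ?thesis by simp
    qed
    have nc: "n choose 2 = l + (l choose 2)" using Suc by (simp add: numeral_2_eq_2)
    have degl: "degree (T l) \<le> n choose 2" using deg[of l] Suc by (simp add: numeral_2_eq_2)
    have coeffl: "coeff (T l) (n choose 2) = 1 / fact l"
    proof -
      \<comment> \<open>Here the constant term is needed: with degree 0 it forces
        \<open>P 0 = 1\<close>, so \<open>T l\<close> is \<open>qnum l * P l\<close>.\<close>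
      have "degree (P 0) = 0" "coeff (P 0) 0 = 1" using P(2)[of 0] P(4)[of 0] by (simp_all add: numeral_2_eq_2)
      then have "P 0 = 1" by (metis degree_eq_zeroE coeff_pCons_0 one_pCons)
      then show ?thesis
        by (simp add: T_def nc coeff_mult_le_degree_sum[OF degree_qnum P(2)] coeff_qnum P(3))
    qed
    have "of_nat n * \<phi> (power_sum (Suc n)) =
       (\<Sum>k\<le>l. (1 - qvar ^ Suc k) * \<phi> (power_sum (Suc k)) * \<phi> (power_sum (Suc (l - k))))"
      using power_sum_recurrence[of l] Suc by simp
    also have "\<dots> = (\<Sum>k\<le>l. (1 - qvar) ^ n * to_fract (T k))"
    proof (rule sum.cong)
      fix k assume "k \<in> {..l}"
      then have k: "k \<le> l" and n: "(1 - qvar) ^ n = (1 - qvar) * (1 - qvar) ^ k * (1 - qvar) ^ (l - k)"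
        using Suc by (simp_all flip: power_add)
      show "(1 - qvar ^ Suc k) * \<phi> (power_sum (Suc k)) * \<phi> (power_sum (Suc (l - k))) = (1 - qvar) ^ n * to_fract (T k)"
        using k unfolding qnum_geometric[symmetric] n by (simp add: P(1) T_def)
    qed simp
    finally have "of_nat n * \<phi> (power_sum (Suc n)) = (1 - qvar) ^ n * to_fract (\<Sum>k\<le>l. T k)"
      by (simp add: sum_distrib_left)
    then have "\<phi> (power_sum (Suc n)) = (1 - qvar) ^ n * to_fract R"
      unfolding R_def to_fract_smult_inverse using Suc
      by (simp add: nonzero_eq_divide_eq mult.commute del: of_nat_Suc to_fract_sum)
    moreover have "degree R \<le> n choose 2"
      unfolding R_def using deg' degl
      by (intro order_trans[OF degree_smult_le] degree_sum_le) (auto simp: le_less)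
    moreover have "coeff R (n choose 2) = 1 / fact n"
    proof -
      have "coeff (\<Sum>k\<le>l. T k) (n choose 2) = (\<Sum>k<l. coeff (T k) (n choose 2)) + 1 / fact l"
        by (simp add: coeff_sum coeffl flip: lessThan_Suc_atMost)
      also have "(\<Sum>k<l. coeff (T k) (n choose 2)) = 0"
        using deg' by (intro sum.neutral) (auto simp: coeff_eq_0)
      finally show ?thesis using Suc by (simp add: R_def)
    qed
    moreover have "coeff R 0 = 1"
      using Suc by (simp add: R_def T_def coeff_sum coeff_mult_0 coeff_qnum P(4))
    ultimately show ?thesis by blast
  qed
qed

end

subsection \<open>Divisibility by powers of $1-q$ and top degree\<close>

lemma size_le_sum_mset: "0 \<notin># X \<Longrightarrow> size X \<le> sum_mset (X :: nat multiset)"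
  by (induction X) auto

lemma degree_sum_mset_le:
  "(\<And>b. b \<in># Y \<Longrightarrow> degree (f b) \<le> d) \<Longrightarrow> degree (\<Sum>b\<in>#Y. f b) \<le> d"
  by (induction Y) (auto intro: degree_add_le)

lemma coeff_sum_mset: "coeff (\<Sum>b\<in>#Y. f b) i = (\<Sum>b\<in>#Y. coeff (f b) i)"
  by (induction Y) simp_all

lemma to_fract_sum_mset: "to_fract (\<Sum>b\<in>#Y. f b) = (\<Sum>b\<in>#Y. to_fract (f b))"
  by (induction Y) simp_all

context specialization
begin

text \<open>Induction on the number of parts: both removing a part and merging it into another one
  leave fewer parts. A degree bound suffices, as the coefficient at the bound is nonzero.\<close>

lemma augm_poly:
  assumes "X \<noteq> {#}" "0 \<notin># X"
  shows "\<exists>M. \<phi> (augm X) = (1 - qvar) ^ (sum_mset X - size X) * to_fract M \<and>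
    degree M \<le> ((sum_mset X - 1) choose 2) + size X - 1 \<and>
    coeff M (((sum_mset X - 1) choose 2) + size X - 1) = fact (size X - 1) / fact (sum_mset X - 1)"
  using assms
proof (induction "size X" arbitrary: X rule: less_induct)
  case less
  from less.prems obtain x Y where X: "X = add_mset x Y" by (meson multiset_cases)
  have x: "x > 0" and Y0: "0 \<notin># Y" using less.prems X by auto
  show ?case
  proof (cases "Y = {#}")
    case True
    then show ?thesis using power_sum_poly[of "x - 1"] x by (auto simp: X hom_augm_single)
  next
    case False
    define s r where "s = sum_mset Y" and "r = size Y"
    have r: "r > 0" using False by (auto simp: r_def nonempty_has_size)
    have rs: "r \<le> s" using size_le_sum_mset[OF Y0] by (simp add: r_def s_def)
    obtain P where P: "\<phi> (power_sum x) = (1 - qvar) ^ (x - 1) * to_fract P" "degree P \<le> (x - 1) choose 2"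
      using power_sum_poly[of "x - 1"] x by auto
    have "\<exists>M. \<phi> (augm Y) = (1 - qvar) ^ (s - r) * to_fract M \<and> degree M \<le> ((s - 1) choose 2) + r - 1"
      using less.hyps[of Y] False Y0 by (auto simp: X s_def r_def)
    then obtain M where M: "\<phi> (augm Y) = (1 - qvar) ^ (s - r) * to_fract M" "degree M \<le> ((s - 1) choose 2) + r - 1"
      by blast
    \<comment> \<open>The bound for the merged multisets, which have r parts and sum x + s; the
      bound for \<open>X\<close>, with one more part, is \<open>Suc ?d\<close>.\<close>
    let ?d = "((x + s - 1) choose 2) + r - 1"
    have "\<exists>N. \<phi> (augm (add_mset (b + x) (Y - {#b#}))) = (1 - qvar) ^ (x + s - r) * to_fract N \<and>
      degree N \<le> ?d \<and> coeff N ?d = fact (r - 1) / fact (x + s - 1)" if b: "b \<in># Y" for b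
    proof -
      obtain Z where Z: "Y = add_mset b Z" using b by (meson multi_member_split)
      have "0 \<notin># add_mset (b + x) Z" using x Y0 Z by auto
      from less.hyps[OF _ _ this] show ?thesis
        by (simp add: X Z s_def r_def add.commute add.left_commute)
    qed
    then have "\<forall>b\<in>set_mset Y. \<exists>N. \<phi> (augm (add_mset (b + x) (Y - {#b#}))) = (1 - qvar) ^ (x + s - r) * to_fract N \<and>
      degree N \<le> ?d \<and> coeff N ?d = fact (r - 1) / fact (x + s - 1)" by blast
    from bchoice[OF this] obtain N where N:
      "\<And>b. b \<in># Y \<Longrightarrow> \<phi> (augm (add_mset (b + x) (Y - {#b#}))) = (1 - qvar) ^ (x + s - r) * to_fract (N b)"
      "\<And>b. b \<in># Y \<Longrightarrow> degree (N b) \<le> ?d"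
      "\<And>b. b \<in># Y \<Longrightarrow> coeff (N b) ?d = fact (r - 1) / fact (x + s - 1)"
      by auto
    define S where "S = (\<Sum>b\<in>#Y. N b)"
    define R where "R = P * M - [:1, -1:] * S"
    have degS: "degree S \<le> ?d" unfolding S_def by (rule degree_sum_mset_le) (rule N)
    \<comment> \<open>There are r merged multisets, counted with multiplicity, and r * (r - 1)! =
      r!.\<close>
    have "coeff S ?d = (\<Sum>b\<in>#Y. fact (r - 1) / fact (x + s - 1))"
      unfolding S_def coeff_sum_mset by (intro arg_cong[of _ _ sum_mset] image_mset_cong) (rule N)
    also have "\<dots> = fact r / fact (x + s - 1)"
      using r by (cases r) (simp_all add: r_def[symmetric] sum_mset_constant)
    finally have coeffS: "coeff S ?d = fact r / fact (x + s - 1)" .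
    \<comment> \<open>The product \<open>P * M\<close> stays below degree \<open>Suc ?d\<close>, so
      the top coefficient comes from \<open>S\<close> alone.\<close>
    have "x + s - 1 = (x - 1) + (s - 1) + 1" using x r rs by linarith
    then have "((x - 1) choose 2) + ((s - 1) choose 2) \<le> (x + s - 1) choose 2"
      by (simp only: choose_two_add)
    then have degPM: "degree (P * M) < Suc ?d"
      using degree_mult_le[of P M] P(2) M(2) r by linarith
    have d: "((x + s - 1) choose 2) + Suc r - 1 = Suc ?d" using r by simp
    have "\<phi> (augm X) = \<phi> (power_sum x) * \<phi> (augm Y) - (\<Sum>b\<in>#Y. \<phi> (augm (add_mset (b + x) (Y - {#b#}))))"
      using hom_power_sum_augm[OF x Y0] by (simp add: X)
    also have "(\<Sum>b\<in>#Y. \<phi> (augm (add_mset (b + x) (Y - {#b#})))) = (\<Sum>b\<in>#Y. (1 - qvar) ^ (x + s - r) * to_fract (N b))"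
      by (intro arg_cong[of _ _ sum_mset] image_mset_cong) (rule N)
    also have "\<dots> = (1 - qvar) ^ (x + s - r) * to_fract S"
      by (simp add: S_def to_fract_sum_mset sum_mset_distrib_left)
    \<comment> \<open>A merged multiset has one part less than \<open>X\<close>, hence one more
      factor 1 - q; this is the factor in front of \<open>S\<close> in \<open>R\<close>.\<close>
    also have "x + s - r = Suc (x + s - Suc r)" using rs x by linarith
    also have "\<phi> (power_sum x) * \<phi> (augm Y) = (1 - qvar) ^ (x + s - Suc r) * to_fract (P * M)"
    proof -
      have "x + s - Suc r = (x - 1) + (s - r)" using rs x by linarith
      then show ?thesis by (simp add: P(1) M(1) power_add)
    qed
    finally have "\<phi> (augm X) = (1 - qvar) ^ (x + s - Suc r) * to_fract R"
    proof -
      have "to_fract [:1, -1:] = 1 - qvar" 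
        unfolding qvar_def to_fract_1[symmetric] to_fract_diff[symmetric] by (simp add: one_pCons)
      then have R: "to_fract R = to_fract (P * M) - (1 - qvar) * to_fract S"
        by (simp only: R_def to_fract_diff to_fract_mult)
      show "\<phi> (augm X) = (1 - qvar) ^ (x + s - Suc r) * to_fract R"
        if "\<phi> (augm X) = (1 - qvar) ^ (x + s - Suc r) * to_fract (P * M) - (1 - qvar) ^ Suc (x + s - Suc r) * to_fract S"
        unfolding that R by (simp add: algebra_simps)
    qed
    moreover have "degree R \<le> Suc ?d"
      unfolding R_def
      using degPM degree_mult_le[of "[:1, -1 :: rat:]" S] degS
      by (intro degree_diff_le) auto
    \<comment> \<open>The leading coefficient -1 of 1 - q cancels the minus sign in
      \<open>R\<close>.\<close>
    moreover have "coeff R (Suc ?d) = fact r / fact (x + s - 1)"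
      using coeff_mult_le_degree_sum[of "[:1, -1 :: rat:]" 1 S ?d] degS coeffS degPM
      by (simp add: R_def coeff_eq_0)
    ultimately show ?thesis
      using d by (intro exI[of _ R]) (simp add: X s_def[symmetric] r_def[symmetric])
  qed
qed

end

subsection \<open>Removing the first column\<close>

text \<open>An order-free form of 2n(\<lambda>) + |\<lambda>|; the pairs are ordered and include
  each part with itself.\<close>

definition pair_min :: "nat multiset \<Rightarrow> nat" where
  "pair_min X = (\<Sum>x\<in>#X. \<Sum>y\<in>#X. min x y)"

definition uncolumn :: "nat multiset \<Rightarrow> nat multiset" where
  "uncolumn X = filter_mset (\<lambda>x. x \<noteq> 0) (image_mset (\<lambda>x. x - 1) X)"

text \<open>This is $\lambda'!$; the upper bound only has to exceed the largest part, since empty columns contribute $0!$.\<close>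

definition column_fact :: "nat multiset \<Rightarrow> nat" where
  "column_fact X = (\<Prod>c=1..sum_mset X. fact (size (filter_mset (\<lambda>x. c \<le> x) X)))"

lemma member_le_sum_mset: "x \<in># X \<Longrightarrow> x \<le> sum_mset (X :: nat multiset)"
  by (auto dest: multi_member_split)

lemma sum_mset_filter_nonzero:
  fixes f :: "nat \<Rightarrow> nat"
  assumes "f 0 = 0"
  shows "(\<Sum>x\<in>#filter_mset (\<lambda>x. x \<noteq> 0) X. f x) = (\<Sum>x\<in>#X. f x)"
  by (induction X) (use assms in auto)

lemma zero_notin_uncolumn: "0 \<notin># uncolumn X"
  by (simp add: uncolumn_def)

lemma size_uncolumn: "size (uncolumn X) \<le> size X"
  unfolding uncolumn_def by (metis size_filter_mset_lesseq size_image_mset)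

lemma sum_mset_uncolumn:
  assumes "0 \<notin># X"
  shows "sum_mset X = size X + sum_mset (uncolumn X)"
proof -
  have "sum_mset (uncolumn X) = (\<Sum>x\<in>#X. x - 1)"
    using sum_mset_filter_nonzero[of "\<lambda>x. x" "image_mset (\<lambda>x. x - 1) X"] by (simp add: uncolumn_def)
  moreover have "sum_mset X = size X + (\<Sum>x\<in>#X. x - 1)"
    using assms by (induction X) auto
  ultimately show ?thesis by simp
qed

text \<open>Each ordered pair of positive parts loses one in its minimum, and parts that become zero
  contribute nothing.\<close>

lemma pair_min_uncolumn:
  assumes "0 \<notin># X"
  shows "pair_min X = size X * size X + pair_min (uncolumn X)"
proof -
  have "pair_min (uncolumn X) = (\<Sum>x\<in>#uncolumn X. \<Sum>y\<in>#image_mset (\<lambda>x. x - 1) X. min x y)"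
    unfolding pair_min_def uncolumn_def by (subst sum_mset_filter_nonzero) simp_all
  also have "\<dots> = (\<Sum>x\<in>#image_mset (\<lambda>x. x - 1) X. \<Sum>y\<in>#image_mset (\<lambda>x. x - 1) X. min x y)"
    unfolding uncolumn_def by (subst sum_mset_filter_nonzero) simp_all
  also have "\<dots> = (\<Sum>x\<in>#X. \<Sum>y\<in>#X. min (x - 1) (y - 1))"
    by (simp add: multiset.map_comp o_def)
  finally have eq: "pair_min (uncolumn X) = (\<Sum>x\<in>#X. \<Sum>y\<in>#X. min (x - 1) (y - 1))" .
  have "min x y = 1 + min (x - 1) (y - 1)" if "x \<in># X" "y \<in># X" for x y
  proof -
    have "x \<noteq> 0" "y \<noteq> 0" using that assms by metis+
    then show ?thesis by simp
  qed
  then have "pair_min X = (\<Sum>x\<in>#X. \<Sum>y\<in>#X. 1 + min (x - 1) (y - 1))"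
    unfolding pair_min_def by (intro arg_cong[of _ _ sum_mset] image_mset_cong)
  also have "\<dots> = size X * size X + (\<Sum>x\<in>#X. \<Sum>y\<in>#X. min (x - 1) (y - 1))"
    by (simp only: sum_mset.distrib sum_mset_constant) simp
  finally show ?thesis using eq by simp
qed

lemma column_fact_bound:
  assumes "\<And>x. x \<in># X \<Longrightarrow> x \<le> n"
  shows "column_fact X = (\<Prod>c=1..n. fact (size (filter_mset (\<lambda>x. c \<le> x) X)))"
proof -
  let ?f = "\<lambda>c. fact (size (filter_mset (\<lambda>x. c \<le> x) X)) :: nat"
  have empty: "?f c = 1" if "\<And>x. x \<in># X \<Longrightarrow> x < c" for c
  proof -
    have "set_mset (filter_mset (\<lambda>x. c \<le> x) X) = {}"
      using that by (auto simp: not_le)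
    then show ?thesis by (simp only: set_mset_eq_empty_iff) simp
  qed
  \<comment> \<open>The smaller bound still dominates every part, so both products can be cut down
    to it.\<close>
  let ?m = "min n (sum_mset X)"
  have "prod ?f {1..k} = prod ?f {1..?m}" if "?m \<le> k" for k
  proof (rule prod.mono_neutral_right)
    show "\<forall>i\<in>{1..k} - {1..?m}. ?f i = 1"
    proof
      fix i assume "i \<in> {1..k} - {1..?m}"
      then have "?m < i" by auto
      moreover have "x \<le> ?m" if "x \<in># X" for x
        using that by (simp add: assms member_le_sum_mset)
      ultimately show "?f i = 1" by (intro empty) (meson le_less_trans)
    qed
  qed (use that in auto)
  then show ?thesis unfolding column_fact_def by (metis min.cobounded1 min.cobounded2)
qed

text \<open>Column c of the smaller partition is column c + 1 of \<open>X\<close>; only the first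
  column, of height \<open>size X\<close>, splits off.\<close>

lemma column_fact_uncolumn:
  assumes "0 \<notin># X"
  shows "column_fact X = fact (size X) * column_fact (uncolumn X)"
proof -
  let ?n = "sum_mset X"
  have size: "size (filter_mset (\<lambda>x. c \<le> x) (uncolumn X)) = size (filter_mset (\<lambda>x. Suc c \<le> x) X)" if "c \<ge> 1" for c
  proof -
    have "filter_mset (\<lambda>x. c \<le> x) (uncolumn X) = image_mset (\<lambda>x. x - 1) (filter_mset (\<lambda>x. Suc c \<le> x) X)"
      using that by (simp add: uncolumn_def filter_filter_mset filter_mset_image_mset) 
        (intro arg_cong[of _ _ "image_mset _"] filter_mset_cong, auto)
    then show ?thesis by simp
  qed
  have le: "x \<le> ?n" if "x \<in># uncolumn X" for x
    using that by (auto simp: uncolumn_def dest!: member_le_sum_mset)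
  \<comment> \<open>One factor too many, equal to 1, so that the index shift after splitting off c =
    1 ends at \<open>?n\<close>.\<close>
  have "column_fact X = (\<Prod>c=1..Suc ?n. fact (size (filter_mset (\<lambda>x. c \<le> x) X)))"
    by (rule column_fact_bound) (auto dest: member_le_sum_mset)
  also have "\<dots> = fact (size (filter_mset (\<lambda>x. 1 \<le> x) X)) * (\<Prod>c=1..?n. fact (size (filter_mset (\<lambda>x. Suc c \<le> x) X)))"
    by (subst prod.atLeast_Suc_atMost, simp, simp only: prod.shift_bounds_cl_Suc_ivl)
  also have "filter_mset (\<lambda>x. 1 \<le> x) X = X"
    using assms by (simp add: filter_mset_eq_conv Suc_le_eq) (metis gr0I)
  also have "(\<Prod>c=1..?n. fact (size (filter_mset (\<lambda>x. Suc c \<le> x) X))) = column_fact (uncolumn X)"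
    by (subst column_fact_bound[OF le]) (auto intro!: prod.cong simp: size)
  finally show ?thesis .
qed

lemma column_fact_pos: "column_fact X > 0"
  unfolding column_fact_def by (simp add: prod_pos)

lemma column_fact_conj_partition: "parts_fact (conj_partition la) = column_fact (mset la)"
proof -
  let ?n = "Max (insert 0 (set la))"
  have "column_fact (mset la) = (\<Prod>c=1..?n. fact (size (filter_mset (\<lambda>x. c \<le> x) (mset la))))"
    by (rule column_fact_bound) simp
  also have "\<dots> = (\<Prod>c\<leftarrow>[1..<Suc ?n]. fact (length (filter (\<lambda>x. c \<le> x) la)))"
  proof -
    have set: "{1..?n} = set [1..<Suc ?n]" by auto
    show ?thesis unfolding set
      by (subst prod.distinct_set_conv_list) (simp_all flip: mset_filter)
  qed
  finally show ?thesis by (simp add: parts_fact_def conj_partition_def o_def)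
qed

lemma n_stat_snoc: "n_stat (xs @ [x]) = n_stat xs + length xs * x"
  by (simp add: n_stat_def nth_append)

text \<open>The smallest part x, appended last, is the minimum with each earlier part in both orders
  and once with itself.\<close>

lemma pair_min_n_stat:
  assumes "sorted_wrt (\<ge>) la"
  shows "pair_min (mset la) = 2 * n_stat la + sum_list la"
  using assms
proof (induction la rule: rev_induct)
  case (snoc x xs)
  have "\<forall>y\<in>set xs. x \<le> y" using snoc.prems by (simp add: sorted_wrt_append)
  then have "(\<Sum>y\<in>#mset xs. min x y) = (\<Sum>y\<in>#mset xs. x)" "(\<Sum>y\<in>#mset xs. min y x) = (\<Sum>y\<in>#mset xs. x)"
    by (intro arg_cong[of _ _ sum_mset] image_mset_cong; simp)+
  then have "pair_min (mset (xs @ [x])) = pair_min (mset xs) + 2 * (length xs * x) + x"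
    by (simp add: pair_min_def sum_mset.distrib)
  with snoc show ?case by (simp add: n_stat_snoc sorted_wrt_append)
qed (simp add: pair_min_def n_stat_def)

section \<open>Vertical strips: products of a squarefree monomial with a monomial of the reduced
  type\<close>

lemma mtype_filter:
  assumes "finite K" "Poly_Mapping.keys m \<subseteq> K"
  shows "mtype m = filter_mset (\<lambda>x. x \<noteq> 0) (image_mset (Poly_Mapping.lookup m) (mset_set K))"
proof -
  have "filter_mset (\<lambda>x. x \<noteq> 0) (mtype m) = mtype m"
    unfolding filter_mset_eq_conv using zero_notin_mtype[of m] by auto (metis gr0I)
  moreover have "filter_mset (\<lambda>x. x \<noteq> 0) (replicate_mset k 0) = {#}" for k :: nat
    by (induction k) simp_all
  ultimately show ?thesis by (simp only: mtype_superset[OF assms] filter_union_mset) simp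
qed

text \<open>Zero exponents do not affect the sum of minima, so monomials with different supports can
  be compared term by term on a common \<open>K\<close>.\<close>

lemma pair_min_mtype:
  assumes "finite K" "Poly_Mapping.keys m \<subseteq> K"
  shows "pair_min (mtype m) = (\<Sum>(i, j)\<in>K \<times> K. min (Poly_Mapping.lookup m i) (Poly_Mapping.lookup m j))"
proof -
  let ?X = "image_mset (Poly_Mapping.lookup m) (mset_set K)"
  have "pair_min (mtype m) = (\<Sum>x\<in>#mtype m. \<Sum>y\<in>#?X. min x y)"
    unfolding pair_min_def mtype_filter[OF assms] by (subst sum_mset_filter_nonzero) simp_all
  also have "\<dots> = (\<Sum>x\<in>#?X. \<Sum>y\<in>#?X. min x y)"
    unfolding mtype_filter[OF assms] by (subst sum_mset_filter_nonzero) simp_all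
  also have "\<dots> = (\<Sum>i\<in>K. \<Sum>j\<in>K. min (Poly_Mapping.lookup m i) (Poly_Mapping.lookup m j))"
    by (simp add: multiset.map_comp o_def sum_unfold_sum_mset)
  finally show ?thesis by (simp add: sum.cartesian_product)
qed

lemma mtype_ones_iff:
  "mtype s = replicate_mset k 1 \<longleftrightarrow>
   card (Poly_Mapping.keys s) = k \<and> (\<forall>i\<in>Poly_Mapping.keys s. Poly_Mapping.lookup s i = 1)"
proof
  assume s: "mtype s = replicate_mset k 1"
  then have "card (Poly_Mapping.keys s) = k" by (metis size_mtype size_replicate_mset)
  moreover have "set_mset (mtype s) \<subseteq> {1}" unfolding s by simp
  ultimately show "card (Poly_Mapping.keys s) = k \<and> (\<forall>i\<in>Poly_Mapping.keys s. Poly_Mapping.lookup s i = 1)"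
    by (auto simp: set_mset_mtype)
next
  assume s: "card (Poly_Mapping.keys s) = k \<and> (\<forall>i\<in>Poly_Mapping.keys s. Poly_Mapping.lookup s i = 1)"
  then have "mtype s = image_mset (\<lambda>_. 1) (mset_set (Poly_Mapping.keys s))"
    unfolding mtype_def by (intro image_mset_cong) auto
  with s show "mtype s = replicate_mset k 1" by (simp add: image_mset_const_eq)
qed

lemma keys_add_nat: "Poly_Mapping.keys (a + b :: monomial) = Poly_Mapping.keys a \<union> Poly_Mapping.keys b"
  by (auto simp: in_keys_iff lookup_add)

lemma image_pred_eq:
  assumes "0 \<notin># X"
  shows "image_mset (\<lambda>x. x - 1) X = uncolumn X + replicate_mset (size X - size (uncolumn X)) 0"
proof -
  let ?Y = "image_mset (\<lambda>x. x - 1) X"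
  have "?Y = uncolumn X + filter_mset (\<lambda>x. \<not> x \<noteq> 0) ?Y"
    unfolding uncolumn_def by (rule multiset_partition)
  also have "filter_mset (\<lambda>x. \<not> x \<noteq> 0) ?Y = replicate_mset (count ?Y 0) 0"
    using filter_eq_replicate_mset[of 0 ?Y] by simp
  finally have eq: "?Y = uncolumn X + replicate_mset (count ?Y 0) 0" .
  moreover from arg_cong[OF this, of size] have "count ?Y 0 = size X - size (uncolumn X)" by simp
  ultimately show ?thesis by simp
qed

text \<open>When the support of \<open>a\<close> lies inside that of \<open>s\<close>, every
  exponent of \<open>a\<close> on the support of \<open>s\<close> is raised by one. This restores
  the first column, the zeros becoming the parts 1 of \<open>X\<close>.\<close>

lemma vertical_strip_first_column:
  assumes X: "0 \<notin># X" and s: "mtype s = replicate_mset (size X) 1" and a: "mtype a = uncolumn X"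
    and sub: "Poly_Mapping.keys a \<subseteq> Poly_Mapping.keys s"
  shows "mtype (s + a) = X"
proof -
  let ?K = "Poly_Mapping.keys s"
  note s' = s[unfolded mtype_ones_iff]
  have "card (?K - Poly_Mapping.keys a) = size X - size (uncolumn X)"
    using sub s' by (simp add: card_Diff_subset size_mtype flip: a)
  then have "image_mset (Poly_Mapping.lookup a) (mset_set ?K) = image_mset (\<lambda>x. x - 1) X"
    unfolding mtype_superset[OF finite_keys sub] a image_pred_eq[OF X] by simp
  then have "image_mset Suc (image_mset (Poly_Mapping.lookup a) (mset_set ?K)) = image_mset Suc (image_mset (\<lambda>x. x - 1) X)"
    by simp
  also have "\<dots> = image_mset (\<lambda>x. x) X"
    unfolding multiset.map_comp o_def by (intro image_mset_cong) (metis X Suc_diff_1 neq0_conv)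
  also have "image_mset Suc (image_mset (Poly_Mapping.lookup a) (mset_set ?K)) = mtype (s + a)"
    unfolding multiset.map_comp o_def mtype_def keys_add_nat using sub s'
    by (simp add: Un_absorb2) (intro image_mset_cong, simp add: lookup_add)
  finally show ?thesis by simp
qed

text \<open>The minimum is superadditive, and it is strictly so at an index occurring only in
  \<open>a\<close> paired with one occurring only in \<open>s\<close>. The former index also
  enlarges the support of \<open>s\<close>.\<close>

lemma vertical_strip_other:
  assumes X: "0 \<notin># X" and s: "mtype s = replicate_mset (size X) 1" and a: "mtype a = uncolumn X"
    and nsub: "\<not> Poly_Mapping.keys a \<subseteq> Poly_Mapping.keys s"
  shows "pair_min (mtype (s + a)) > pair_min X" and "size (mtype (s + a)) > size X"
proof -
  let ?S = "Poly_Mapping.keys s" and ?A = "Poly_Mapping.keys a"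
  let ?s = "Poly_Mapping.lookup s" and ?a = "Poly_Mapping.lookup a"
  note s' = s[unfolded mtype_ones_iff]
  obtain i where i: "i \<in> ?A" "i \<notin> ?S" using nsub by blast
  \<comment> \<open>The support of \<open>a\<close> is no larger than that of \<open>s\<close> and
    not contained in it, so it cannot contain it either.\<close>
  have "card ?A \<le> card ?S"
    using s' size_uncolumn[of X] by (simp add: size_mtype flip: a)
  then have "\<not> ?S \<subseteq> ?A"
    using i by (metis card_subset_eq finite_keys le_antisym card_mono)
  then obtain j where j: "j \<in> ?S" "j \<notin> ?A" by blast
  have "card ?S < card (?S \<union> ?A)"
    using i by (intro psubset_card_mono) auto
  then show "size (mtype (s + a)) > size X"
    using s' by (simp add: size_mtype keys_add_nat)
  let ?K = "?S \<union> ?A"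
  have "pair_min X = pair_min (mtype s) + pair_min (mtype a)"
    unfolding s a pair_min_uncolumn[OF X] by (simp add: pair_min_def)
  also have "\<dots> = (\<Sum>(i, j)\<in>?K \<times> ?K. min (?s i) (?s j) + min (?a i) (?a j))"
    by (simp add: pair_min_mtype[of ?K] sum.distrib case_prod_unfold)
  also have "\<dots> < (\<Sum>(i, j)\<in>?K \<times> ?K. min (?s i + ?a i) (?s j + ?a j))"
  proof (rule sum_strict_mono_ex1)
    have "?s i = 0" "?a j = 0" using i j by (auto simp: in_keys_iff)
    moreover have "?a i > 0" "?s j > 0" using i j by (auto simp: in_keys_iff)
    ultimately show "\<exists>x\<in>?K \<times> ?K. (case x of (i, j) \<Rightarrow> min (?s i) (?s j) + min (?a i) (?a j))
       < (case x of (i, j) \<Rightarrow> min (?s i + ?a i) (?s j + ?a j))"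
      using i j by (intro bexI[of _ "(i, j)"]) auto
  qed (auto simp: min_def)
  also have "\<dots> = pair_min (mtype (s + a))"
    by (simp add: pair_min_mtype[of ?K] keys_add_nat lookup_add)
  finally show "pair_min X < pair_min (mtype (s + a))" .
qed

text \<open>The squarefree factor has as many variables as \<open>m\<close> and uses only those, so
  it is the product of all variables of \<open>m\<close>.\<close>

lemma vertical_strip_unique:
  assumes X: "0 \<notin># X" and m: "mtype m = X"
  shows "\<exists>p. {(s, a). s + a = m \<and> mtype s = replicate_mset (size X) 1 \<and> mtype a = uncolumn X} = {p}"
proof -
  let ?K = "Poly_Mapping.keys m"
  define s0 :: monomial where "s0 = Poly_Mapping.map (\<lambda>_. 1) m"
  have s0: "Poly_Mapping.lookup s0 i = (if i \<in> ?K then 1 else 0)" for i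
    by (simp add: s0_def map.rep_eq when_def in_keys_iff)
  have keys_s0: "Poly_Mapping.keys s0 = ?K" by (auto simp: in_keys_iff[of _ s0] s0 split: if_splits)
  have card: "card ?K = size X" by (simp add: m[symmetric] size_mtype)
  have 1: "mtype s0 = replicate_mset (size X) 1"
    unfolding mtype_ones_iff by (simp add: keys_s0 card s0)
  have 2: "s0 + (m - s0) = m"
    by (intro poly_mapping_eqI) (auto simp: lookup_add lookup_minus s0 in_keys_iff)
  have 3: "mtype (m - s0) = uncolumn X"
  proof -
    have "mtype (m - s0) = filter_mset (\<lambda>x. x \<noteq> 0) (image_mset (Poly_Mapping.lookup (m - s0)) (mset_set ?K))"
      by (rule mtype_filter) (auto simp: in_keys_iff lookup_minus)
    also have "image_mset (Poly_Mapping.lookup (m - s0)) (mset_set ?K) = image_mset (\<lambda>i. Poly_Mapping.lookup m i - 1) (mset_set ?K)"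
      by (rule image_mset_cong) (simp add: lookup_minus s0)
    finally show ?thesis by (simp add: uncolumn_def m[symmetric] mtype_def multiset.map_comp o_def)
  qed
  have 4: "s = s0 \<and> a = m - s0" if "s + a = m" "mtype s = replicate_mset (size X) 1" for s a
  proof -
    note s' = that(2)[unfolded mtype_ones_iff]
    have "Poly_Mapping.keys s \<subseteq> ?K" using that(1) by (auto simp: keys_add_nat)
    then have "Poly_Mapping.keys s = ?K" using s' card by (intro card_subset_eq) auto
    then have "Poly_Mapping.lookup s i = Poly_Mapping.lookup s0 i" for i
      using s' by (auto simp: s0 in_keys_iff)
    then have "s = s0" by (rule poly_mapping_eqI)
    then show ?thesis using that(1) by auto
  qed
  have "{(s, a). s + a = m \<and> mtype s = replicate_mset (size X) 1 \<and> mtype a = uncolumn X} = {(s0, m - s0)}"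
    (is "?B = _")
  proof
    show "?B \<subseteq> {(s0, m - s0)}" using 4 by blast
    show "{(s0, m - s0)} \<subseteq> ?B" using 1 2 3 by blast
  qed
  then show ?thesis by blast
qed

text \<open>The coefficient of the monomial in $e_k m_\mu$, where $\mu$ is the partition without its first column, of length $k$.\<close>

definition strip_coeff :: "nat multiset \<Rightarrow> monomial \<Rightarrow> nat" where
  "strip_coeff X m = card {(s, a). s + a = m \<and> mtype s = replicate_mset (size X) 1 \<and> mtype a = uncolumn X}"

lemma series_mult_msym_uncolumn:
  "series_mult (msym (replicate_mset (size X) 1)) (msym (uncolumn X)) m = of_nat (strip_coeff X m)"
proof -
  let ?B = "{(s, a). s + a = m \<and> mtype s = replicate_mset (size X) 1 \<and> mtype a = uncolumn X}"
  have "series_mult (msym (replicate_mset (size X) 1)) (msym (uncolumn X)) m = (\<Sum>p\<in>?B. 1)"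
    unfolding series_mult_def
    by (rule sum.mono_neutral_cong_right[OF finite_monomial_splittings]) (auto simp: msym_def split: if_splits)
  then show ?thesis by (simp add: strip_coeff_def)
qed

lemma strip_coeff_self:
  assumes "0 \<notin># X" "mtype m = X"
  shows "strip_coeff X m = 1"
proof -
  obtain p where
    "{(s, a). s + a = m \<and> mtype s = replicate_mset (size X) 1 \<and> mtype a = uncolumn X} = {p}"
    using vertical_strip_unique[OF assms] by blast
  then show ?thesis unfolding strip_coeff_def by simp
qed

lemma strip_coeff_other:
  assumes "0 \<notin># X" "strip_coeff X m \<noteq> 0" "mtype m \<noteq> X"
  shows "pair_min (mtype m) > pair_min X" "size (mtype m) > size X"
proof -
  have "{(s, a). s + a = m \<and> mtype s = replicate_mset (size X) 1 \<and> mtype a = uncolumn X} \<noteq> {}"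
    using assms(2) unfolding strip_coeff_def by (metis card.empty)
  then obtain s a where sa: "m = s + a" "mtype s = replicate_mset (size X) 1" "mtype a = uncolumn X" by auto
  then have "\<not> Poly_Mapping.keys a \<subseteq> Poly_Mapping.keys s"
    using vertical_strip_first_column[OF assms(1)] assms(3) by blast
  then show "pair_min (mtype m) > pair_min X" "size (mtype m) > size X"
    using vertical_strip_other[OF assms(1) sa(2,3)] sa(1) by auto
qed

lemma strip_coeff_degree:
  assumes "0 \<notin># X" "strip_coeff X m \<noteq> 0"
  shows "sum_mset (mtype m) = sum_mset X"
proof -
  have "{(s, a). s + a = m \<and> mtype s = replicate_mset (size X) 1 \<and> mtype a = uncolumn X} \<noteq> {}"
    using assms(2) unfolding strip_coeff_def by (metis card.empty)
  then obtain s a where sa: "m = s + a" "mtype s = replicate_mset (size X) 1" "mtype a = uncolumn X" by auto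
  then have "sum_mset (mtype m) = sum_mset (mtype s) + sum_mset (mtype a)"
    by (metis mdeg_add mdeg_eq_sum_mset)
  then show ?thesis
    using sum_mset_uncolumn[OF assms(1)] sa by simp
qed

text \<open>The statistic $n(\lambda)$ on multisets; the truncated operations are exact by \<open>pair_min_half_stat\<close>.\<close>

definition half_stat :: "nat multiset \<Rightarrow> nat" where
  "half_stat X = (pair_min X - sum_mset X) div 2"

lemma half_stat_mset: "sorted_wrt (\<ge>) la \<Longrightarrow> half_stat (mset la) = n_stat la"
  by (simp add: half_stat_def pair_min_n_stat sum_mset_sum_list)

lemma pair_min_half_stat: "pair_min X = 2 * half_stat X + sum_mset X"
proof -
  define la where "la = rev (sorted_list_of_multiset X)"
  have la: "mset la = X" "sorted_wrt (\<ge>) la"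
    by (simp_all add: la_def sorted_wrt_rev)
  then show ?thesis
    using pair_min_n_stat[OF la(2)] half_stat_mset[OF la(2)] by (simp add: sum_mset_sum_list[symmetric])
qed

text \<open>A first column of height k contributes 0 + 1 + ... + (k - 1), exactly the power of q in
  the value of \<open>elem_sym k\<close>.\<close>

lemma half_stat_uncolumn:
  assumes "0 \<notin># X"
  shows "half_stat X = (size X choose 2) + half_stat (uncolumn X)"
proof -
  have "2 * (n choose 2) + n = n * n" for n :: nat
    by (induction n) (simp_all add: numeral_2_eq_2)
  from this[of "size X"] show ?thesis
    using pair_min_uncolumn[OF assms] sum_mset_uncolumn[OF assms]
    by (simp add: pair_min_half_stat)
qed

section \<open>Expansion of the product with an elementary function over partitions of fixed
  size\<close>

lemma finite_partitions: "finite {X. 0 \<notin># X \<and> sum_mset X = (n :: nat)}"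
proof (rule finite_subset)
  show "finite (mset ` {xs. set xs \<subseteq> {..n} \<and> length xs \<le> n})"
    by (intro finite_imageI finite_lists_length_le) simp
  show "{X. 0 \<notin># X \<and> sum_mset X = n} \<subseteq> mset ` {xs. set xs \<subseteq> {..n} \<and> length xs \<le> n}"
  proof
    fix X assume X: "X \<in> {X. 0 \<notin># X \<and> sum_mset X = n}"
    obtain xs where xs: "mset xs = X" using ex_mset by blast
    have "set xs \<subseteq> {..n}" using X xs member_le_sum_mset[of _ X] by auto
    moreover have "length xs \<le> n" using X xs size_le_sum_mset[of X] by auto
    ultimately show "X \<in> mset ` {xs. set xs \<subseteq> {..n} \<and> length xs \<le> n}" using xs by blast
  qed
qed

text \<open>The product is symmetric and homogeneous, so it is a finite combination of monomial
  functions whose coefficients can be read off at one representative per type. The triangularity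
  comes from the vertical strips.\<close>

lemma (in symfun_hom) hom_uncolumn_expansion:
  assumes X: "0 \<notin># X"
  obtains c :: "nat multiset \<Rightarrow> nat" where
    "\<phi> (elem_sym (size X)) * \<phi> (msym (uncolumn X)) = \<phi> (msym X) +
     (\<Sum>Z | 0 \<notin># Z \<and> sum_mset Z = sum_mset X \<and> Z \<noteq> X. of_nat (c Z) * \<phi> (msym Z))"
    "\<And>Z. Z \<in> {Z. 0 \<notin># Z \<and> sum_mset Z = sum_mset X \<and> Z \<noteq> X} \<Longrightarrow> c Z \<noteq> 0 \<Longrightarrow>
       half_stat X < half_stat Z \<and> size X < size Z"
proof -
  define F where "F = (series_mult (msym (replicate_mset (size X) 1)) (msym (uncolumn X)) :: 'a series)"
  define rep where "rep Z = (SOME m. mtype m = Z)" for Z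
  have rep: "mtype (rep Z) = Z" if "0 \<notin># Z" for Z
    unfolding rep_def using ex_mtype[OF that] by (rule someI_ex)
  define c where "c Z = strip_coeff X (rep Z)" for Z
  define T where "T = {Z. 0 \<notin># Z \<and> sum_mset Z = sum_mset X}"
  have finT: "finite T" unfolding T_def by (rule finite_partitions)
  have XT: "X \<in> T" using X by (simp add: T_def)
  have F: "F m = of_nat (strip_coeff X m)" for m
    unfolding F_def by (rule series_mult_msym_uncolumn)
  have F_sym: "F \<in> symfuns"
    by (simp add: F_def series_mult_in_symfuns msym_in_symfuns)
  have expand: "F = (\<lambda>m. \<Sum>Z\<in>#mset_set T. series_scale (of_nat (c Z)) (msym Z) m)"
  proof
    fix m
    have "(\<Sum>Z\<in>#mset_set T. series_scale (of_nat (c Z)) (msym Z) m) =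
        (\<Sum>Z\<in>T. if Z = mtype m then of_nat (c Z) else (0 :: 'a))"
      unfolding sum_unfold_sum_mset
      by (intro arg_cong[of _ _ sum_mset] image_mset_cong) (auto simp: series_scale_def msym_def)
    also have "\<dots> = (if mtype m \<in> T then of_nat (c (mtype m)) else 0)"
      using finT by simp
    also have "\<dots> = F m"
    proof (cases "mtype m \<in> T")
      case True
      have "F (rep (mtype m)) = F m"
        by (rule symfuns_mtype_cong[OF F_sym rep[OF zero_notin_mtype]])
      with True show ?thesis by (simp add: c_def F)
    next
      case False
      then have "strip_coeff X m = 0"
        using strip_coeff_degree[OF X, of m] zero_notin_mtype by (auto simp: T_def)
      with False show ?thesis by (simp add: F)
    qed
    finally show "F m = (\<Sum>Z\<in>#mset_set T. series_scale (of_nat (c Z)) (msym Z) m)" by simp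
  qed
  have "\<phi> F = (\<Sum>Z\<in>#mset_set T. \<phi> (series_scale (of_nat (c Z)) (msym Z)))"
    unfolding expand
    by (rule conjunct2[OF hom_sum_mset]) (simp add: series_scale_in_symfuns msym_in_symfuns)
  also have "\<dots> = (\<Sum>Z\<in>T. of_nat (c Z) * \<phi> (msym Z))"
    by (simp add: sum_unfold_sum_mset hom_scale msym_in_symfuns)
  also have "\<dots> = of_nat (c X) * \<phi> (msym X) + (\<Sum>Z\<in>T - {X}. of_nat (c Z) * \<phi> (msym Z))"
    by (rule sum.remove[OF finT XT])
  also have "c X = 1"
    unfolding c_def by (rule strip_coeff_self[OF X rep[OF X]])
  also have "\<phi> F = \<phi> (elem_sym (size X)) * \<phi> (msym (uncolumn X))"
    by (simp add: F_def hom_mult msym_in_symfuns elem_sym_eq_msym)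
  also have "T - {X} = {Z. 0 \<notin># Z \<and> sum_mset Z = sum_mset X \<and> Z \<noteq> X}"
    by (auto simp: T_def)
  finally have 1: "\<phi> (elem_sym (size X)) * \<phi> (msym (uncolumn X)) = \<phi> (msym X) +
     (\<Sum>Z | 0 \<notin># Z \<and> sum_mset Z = sum_mset X \<and> Z \<noteq> X. of_nat (c Z) * \<phi> (msym Z))" by simp
  show thesis
  proof (rule that[OF 1])
    fix Z assume "Z \<in> {Z. 0 \<notin># Z \<and> sum_mset Z = sum_mset X \<and> Z \<noteq> X}" "c Z \<noteq> 0"
    then have Z: "0 \<notin># Z" "sum_mset Z = sum_mset X" "Z \<noteq> X" "c Z \<noteq> 0" by auto
    have "pair_min Z > pair_min X" "size Z > size X"
      using strip_coeff_other[OF X, of "rep Z"] Z by (simp_all add: c_def rep)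
    with Z(2) show "half_stat X < half_stat Z \<and> size X < size Z"
      by (simp add: pair_min_half_stat)
  qed
qed

section \<open>Order, lowest coefficient and the polynomials J_n\<close>

lemma low_coeff_of_mult:
  fixes A M S :: "'a::comm_ring_1 poly"
  assumes "coeff A 0 = 1" and eq: "A * M = monom 1 n * S"
  shows "\<forall>i<n. coeff M i = 0" and "coeff M n = coeff S 0"
proof -
  have main: "coeff M i = (if i < n then 0 else coeff S 0)" if "i \<le> n" for i
    using that
  proof (induction i rule: less_induct)
    case (less i)
    \<comment> \<open>The lower coefficients of \<open>M\<close> vanish by induction, so only the
      constant coefficient 1 of \<open>A\<close> acts.\<close>
    have "coeff (A * M) i = (\<Sum>j\<le>i. coeff A j * coeff M (i - j))" by (rule coeff_mult)
    also have "\<dots> = (\<Sum>j\<in>{0}. coeff A j * coeff M (i - j))"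
      by (rule sum.mono_neutral_right) (use less in auto)
    finally have "coeff M i = coeff (A * M) i" using assms(1) by simp
    with less.prems show ?case by (simp add: eq coeff_monom_mult)
  qed
  then show "\<forall>i<n. coeff M i = 0" "coeff M n = coeff S 0" by simp_all
qed

context specialization
begin

text \<open>Solve the expansion for the value at \<open>X\<close>. The product starts at q to the
  power \<open>half_stat X\<close> with coefficient 1/k! (k = \<open>size X\<close>) times that of
  the reduced partition, and all other terms start later. The induction is lexicographic: smaller
  size first, then more parts.\<close>

lemma msym_poly:
  assumes "0 \<notin># X"
  shows "\<exists>R. \<phi> (msym X) = qvar ^ half_stat X * to_fract R \<and> coeff R 0 = 1 / of_nat (column_fact X)"
  using assms
proof (induction X rule: wf_induct_rule[OF wf_measures[of "[sum_mset, \<lambda>X. sum_mset X - size X]"]])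
  case (1 X)
  have X: "0 \<notin># X" by fact
  show ?case
  proof (cases "X = {#}")
    case True
    then show ?thesis
      by (intro exI[of _ 1]) (simp add: msym_empty hom_one half_stat_def pair_min_def column_fact_def)
  next
    case False
    let ?T = "{Z. 0 \<notin># Z \<and> sum_mset Z = sum_mset X \<and> Z \<noteq> X}"
    obtain c :: "nat multiset \<Rightarrow> nat" where c:
      "\<phi> (elem_sym (size X)) * \<phi> (msym (uncolumn X)) = \<phi> (msym X) + (\<Sum>Z\<in>?T. of_nat (c Z) * \<phi> (msym Z))"
      "\<And>Z. Z \<in> ?T \<Longrightarrow> c Z \<noteq> 0 \<Longrightarrow> half_stat X < half_stat Z \<and> size X < size Z"
      by (rule hom_uncolumn_expansion[OF X]) (rule that)
    have "sum_mset (uncolumn X) < sum_mset X"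
      using sum_mset_uncolumn[OF X] False by (simp add: nonempty_has_size)
    then obtain R where R: "\<phi> (msym (uncolumn X)) = qvar ^ half_stat (uncolumn X) * to_fract R"
      "coeff R 0 = 1 / of_nat (column_fact (uncolumn X))"
      using "1.IH"[of "uncolumn X"] zero_notin_uncolumn by auto
    have "\<exists>S. of_nat (c Z) * \<phi> (msym Z) = qvar ^ Suc (half_stat X) * to_fract S" if Z: "Z \<in> ?T" for Z
    proof (cases "c Z = 0")
      \<comment> \<open>With coefficient zero nothing is known about \<open>half_stat Z\<close>, but
        the term vanishes.\<close>
      case True
      then show ?thesis by (intro exI[of _ 0]) simp
    next
      case False
      have less: "half_stat X < half_stat Z" "size X < size Z" using c(2)[OF Z False] by auto
      \<comment> \<open>This keeps the truncated subtraction in the measure exact, so more parts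
        mean a strictly smaller value.\<close>
      moreover have "size Z \<le> sum_mset Z" using Z by (intro size_le_sum_mset) simp
      ultimately have "sum_mset Z - size Z < sum_mset X - size X" using Z by simp
      then obtain S where "\<phi> (msym Z) = qvar ^ half_stat Z * to_fract S"
        using "1.IH"[of Z] Z by auto
      moreover have "qvar ^ half_stat Z = qvar ^ Suc (half_stat X) * qvar ^ (half_stat Z - Suc (half_stat X))"
        using less by (simp flip: power_add power_Suc)
      ultimately have "of_nat (c Z) * \<phi> (msym Z) = qvar ^ Suc (half_stat X) *
          to_fract (of_nat (c Z) * [:0, 1:] ^ (half_stat Z - Suc (half_stat X)) * S)"
        by (simp add: to_fract_of_nat to_fract_power qvar_def)
      then show ?thesis ..
    qed
    then have "\<forall>Z\<in>?T. \<exists>S. of_nat (c Z) * \<phi> (msym Z) = qvar ^ Suc (half_stat X) * to_fract S" ..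
    from bchoice[OF this] obtain S where S:
      "\<And>Z. Z \<in> ?T \<Longrightarrow> of_nat (c Z) * \<phi> (msym Z) = qvar ^ Suc (half_stat X) * to_fract (S Z)"
      by auto
    \<comment> \<open>The factor \<open>[:0, 1:]\<close> records the strict inequality of the
      statistics and keeps the sum out of the constant coefficient.\<close>
    define P where "P = smult (1 / of_nat (fact (size X))) R - [:0, 1:] * (\<Sum>Z\<in>?T. S Z)"
    have "(\<Sum>Z\<in>?T. of_nat (c Z) * \<phi> (msym Z)) = (\<Sum>Z\<in>?T. qvar ^ Suc (half_stat X) * to_fract (S Z))"
      by (rule sum.cong) (use S in auto)
    also have "\<dots> = qvar ^ half_stat X * to_fract ([:0, 1:] * (\<Sum>Z\<in>?T. S Z))"
      unfolding to_fract_mult qvar_def by (simp add: sum_distrib_left mult_ac)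
    finally have sum: "(\<Sum>Z\<in>?T. of_nat (c Z) * \<phi> (msym Z)) = qvar ^ half_stat X * to_fract ([:0, 1:] * (\<Sum>Z\<in>?T. S Z))" .
    have "\<phi> (elem_sym (size X)) * \<phi> (msym (uncolumn X)) =
        qvar ^ half_stat X * to_fract (smult (1 / of_nat (fact (size X))) R)"
      unfolding to_fract_smult_inverse by (simp add: elem_sym_val R(1) half_stat_uncolumn[OF X] power_add)
    with c(1) have "\<phi> (msym X) = qvar ^ half_stat X * to_fract P"
      unfolding sum P_def to_fract_diff right_diff_distrib by (simp only: eq_diff_eq)
    moreover have "coeff P 0 = 1 / of_nat (column_fact X)"
      by (simp add: P_def R(2) column_fact_uncolumn[OF X])
    ultimately show ?thesis by blast
  qed
qed

text \<open>The description defining \<open>J_poly\<close> is met by (n - 1)! times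
  \<open>M\<close>, and only by it because powers of 1 - q can be cancelled.\<close>

lemma J_poly_eq:
  assumes "\<phi> (power_sum n) = (1 - qvar) ^ (n - 1) * to_fract M"
  shows "smult (1 / fact (n - 1)) (J_poly \<phi> n) = M"
proof -
  have scale: "to_fract (smult (1 / fact (n - 1)) P) = to_fract P / fact (n - 1)" for P :: "rat poly"
    using to_fract_smult_inverse[of "fact (n - 1)" P] by simp
  have "J_poly \<phi> n = smult (fact (n - 1)) M"
    unfolding J_poly_def
  proof (rule the_equality)
    show "\<phi> (power_sum n) = (1 - qvar) ^ (n - 1) / of_nat (fact (n - 1)) * to_fract (smult (fact (n - 1)) M)"
      using scale[of "smult (fact (n - 1)) M"] by (simp add: assms)
  next
    fix P assume "\<phi> (power_sum n) = (1 - qvar) ^ (n - 1) / of_nat (fact (n - 1)) * to_fract P"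
    then have "(1 - qvar) ^ (n - 1) * to_fract M = (1 - qvar) ^ (n - 1) * to_fract (smult (1 / fact (n - 1)) P)"
      using assms scale[of P] by simp
    then have "M = smult (1 / fact (n - 1)) P" using qvar_neq_one by simp
    then show "P = smult (fact (n - 1)) M" by simp
  qed
  then show ?thesis by simp
qed

end

section \<open>Comparison of the two expressions for the specialized augmented function\<close>

theorem theorem3p1:
  fixes \<phi> :: "ratfun series \<Rightarrow> ratfun" and la :: "nat list"
  assumes "is_specialization \<phi>"
    and "is_partition la" and "sum_list la > 0"
  shows "\<exists>M :: rat poly.
     \<phi> (aug_monomial_sym la) = (1 - qvar) ^ (sum_list la - length la) * to_fract M \<and>
     degree M = ((sum_list la - 1) choose 2) + length la - 1 \<and>
     coeff M (((sum_list la - 1) choose 2) + length la - 1)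
       = fact (length la - 1) / fact (sum_list la - 1) \<and>
     poly_ord M = n_stat la \<and>
     coeff M (n_stat la) = of_nat (mult_fact la) / of_nat (parts_fact (conj_partition la)) \<and>
     (\<forall>n\<ge>1. la = [n] \<longrightarrow> M = smult (1 / fact (n - 1)) (J_poly \<phi> n))"
proof -
  interpret specialization \<phi> by unfold_locales (rule assms)
  let ?X = "mset la" and ?d = "((sum_list la - 1) choose 2) + length la - 1" and ?e = "sum_list la - length la"
  have sorted: "sorted_wrt (\<ge>) la" and X0: "0 \<notin># ?X"
    using assms(2) by (auto simp: is_partition_def)
  have "?X \<noteq> {#}" using assms(3) by auto
  from augm_poly[OF this X0] obtain M where M:
    "\<phi> (aug_monomial_sym la) = (1 - qvar) ^ ?e * to_fract M"
    "degree M \<le> ?d" "coeff M ?d = fact (length la - 1) / fact (sum_list la - 1)"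
    by (auto simp: aug_monomial_sym_eq_augm sum_mset_sum_list)
  have degM: "degree M = ?d"
    using M(2,3) le_degree[of M ?d] by simp
  obtain R where R: "\<phi> (msym ?X) = qvar ^ n_stat la * to_fract R"
    "coeff R 0 = 1 / of_nat (parts_fact (conj_partition la))"
    using msym_poly[OF X0] by (auto simp: half_stat_mset[OF sorted] column_fact_conj_partition)
  \<comment> \<open>One value, computed once through power sums and once through elementary
    functions; embedding into fractions is injective, so the polynomials agree.\<close>
  have "to_fract ((1 - [:0, 1:]) ^ ?e * M) = to_fract (monom 1 (n_stat la) * (of_nat (mult_fact la) * R))"
    using M(1) unfolding aug_monomial_sym_eq_augm hom_augm R(1) mult_fact_eq_mfact qvar_def
    by (simp add: to_fract_power to_fract_of_nat monom_altdef mult_ac)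
  then have eq: "(1 - [:0, 1:]) ^ ?e * M = monom 1 (n_stat la) * (of_nat (mult_fact la) * R)"
    by (simp only: to_fract_eq_iff)
  \<comment> \<open>A factor with constant term 1 changes neither order nor lowest coefficient, so
    both are visible on the right side of \<open>eq\<close>.\<close>
  have "coeff ((1 - [:0, 1:]) ^ ?e) 0 = (1 :: rat)" by (simp add: coeff_0_power)
  note low = low_coeff_of_mult[OF this eq]
  have lowest: "coeff M (n_stat la) = of_nat (mult_fact la) / of_nat (parts_fact (conj_partition la))"
    using low(2) by (simp add: coeff_mult_0 R(2) of_nat_poly)
  have "mult_fact la > 0" by (simp add: mult_fact_def prod_pos)
  moreover have "parts_fact (conj_partition la) > 0"
    by (simp add: column_fact_conj_partition column_fact_pos)
  ultimately have "coeff M (n_stat la) \<noteq> 0" unfolding lowest by simp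
  then have "poly_ord M = n_stat la"
    unfolding poly_ord_def using low(1) by (intro Least_equality) (auto simp: not_less[symmetric])
  moreover have "M = smult (1 / fact (n - 1)) (J_poly \<phi> n)" if "n \<ge> 1" "la = [n]" for n
    using M(1) that by (intro J_poly_eq[symmetric]) (simp add: aug_monomial_sym_eq_augm hom_augm_single)
  ultimately show ?thesis using M degM lowest by blast
qed

end
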